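(* Let $F$ be a $\vartheta$-logarithmically homogeneous self-concordant barrier ($\vartheta$-LHSCB) for $K$ and let $(x,s)\in\operatorname{int}(K)\oplus\operatorname{int}(K^* )$. Then the linear transformation $$T_D^2 := \mu\int_0^1 F_*''(s-t\delta_D)\,dt \;:\; \mathbb{E}^*\to\mathbb{E}$$ is self-adjoint, positive-definite, maps $s$ to $x$, and maps $\tilde s$ to $\tilde x$. Therefore its unique self-adjoint, positive-definite square root $T_D$ is in $\mathcal{T}_1(x,s)$.
   Context: $\mathbb{E}$ is a finite-dimensional real vector space of dimension $n$ with dual $\mathbb{E}^*$ and pairing $\langle\cdot,\cdot\rangle$; $K\subset\mathbb{E}$ is a pointed closed convex cone with nonempty interior, and $K^*:=\{s\in\mathbb{E}^*:\langle s,x\rangle\ge 0\ \forall x\in K\}$. A $\vartheta$-LHSCB for $K$ ($\vartheta\ge1$) is a $\mathcal{C}^3$ convex function $F:\operatorname{int}(K)\to\mathbb{R}$ such that $F\to+\infty$ along every sequence in $\operatorname{int}(K)$ converging to a boundary point of $K$, $F(tx)=F(x)-\vartheta\ln t$ for all $t>0$, and $|D^3F(x)[h,h,h]|\le 2(D^2F(x)[h,h])^{3/2}$ for all $x\in\operatorname{int}(K)$, $h\in\mathbb{E}$. The conjugate barrier is $F_*(s):=\sup\{-\langle s,x\rangle-F(x):x\in\operatorname{int}(K)\}$, which is a $\vartheta$-LHSCB for $K^*$ (known). Here $F'(x)\in\mathbb{E}^*$, $F''(x):\mathbb{E}\to\mathbb{E}^*$, $F_*'(s)\in\mathbb{E}$,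 $F_*''(s):\mathbb{E}^*\to\mathbb{E}$. For $(x,s)\in\operatorname{int}(K)\oplus\operatorname{int}(K^* )$ put $\mu:=\langle s,x\rangle/\vartheta$, $\tilde x:=-F_*'(s)$, $\tilde s:=-F'(x)$, $\delta_D:=s-\mu\tilde s$. An inner product on $\mathbb{E}$ is fixed, so that $\mathbb{E}$ and $\mathbb{E}^*$ are identified with $\mathbb{R}^n$ and self-adjoint positive-definite maps $\mathbb{E}^*\to\mathbb{E}$ with elements of $\mathbb{S}^n_{++}$ (symmetric positive-definite $n\times n$ matrices). Then $\mathcal{T}_1(x,s):=\{T\in\mathbb{S}^n_{++}: T^2(s)=x,\ T^2(\tilde s)=\tilde x\}$. *)

theory Defs
  imports "HOL-Analysis.Analysis"
begin

text \<open>
  The ambient space is a Euclidean space \<open>'a\<close>; its dual is identified with \<open>'a\<close> through the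
  inner product, so the pairing of \<open>s\<close> and \<open>x\<close> is \<open>s \<bullet> x\<close>, the derivative of a real function is
  its gradient, and linear maps from the dual to the space are elements of \<open>'a \<Rightarrow>\<^sub>L 'a\<close>.
  Functions with domain the interior of a cone are total in HOL; their values elsewhere
  are never constrained and never influence anything below.
\<close>

definition proper_cone :: "'a::euclidean_space set \<Rightarrow> bool" where
  "proper_cone K \<longleftrightarrow>
     closed K \<and> convex_cone K \<and> K \<inter> uminus ` K = {0} \<and> interior K \<noteq> {}"

definition dual_cone :: "'a::euclidean_space set \<Rightarrow> 'a set" where
  "dual_cone K = {s. \<forall>x\<in>K. 0 \<le> s \<bullet> x}"

definition grad :: "('a::euclidean_space \<Rightarrow> real) \<Rightarrow> 'a \<Rightarrow> 'a" where
  "grad F x = (THE g. GDERIV F x :> g)"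

definition hess :: "('a::euclidean_space \<Rightarrow> real) \<Rightarrow> 'a \<Rightarrow> 'a \<Rightarrow>\<^sub>L 'a" where
  "hess F x = Blinfun (frechet_derivative (grad F) (at x))"

definition third :: "('a::euclidean_space \<Rightarrow> real) \<Rightarrow> 'a \<Rightarrow> 'a \<Rightarrow>\<^sub>L ('a \<Rightarrow>\<^sub>L 'a)" where
  "third F x = Blinfun (frechet_derivative (hess F) (at x))"

text \<open>Intended for open \<open>S\<close>; continuity of the lower-order derivatives follows from
  differentiability.\<close>

definition C3_on :: "'a::euclidean_space set \<Rightarrow> ('a \<Rightarrow> real) \<Rightarrow> bool" where
  "C3_on S F \<longleftrightarrow>
     (\<forall>x\<in>S. F differentiable (at x) \<and> grad F differentiable (at x) \<and> hess F differentiable (at x)) \<and>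
     continuous_on S (third F)"

text \<open>Here \<open>D\<^sup>2F(x)[h,h] = hess F x h \<bullet> h\<close> and \<open>D\<^sup>3F(x)[h,h,h] = third F x h h \<bullet> h\<close>.\<close>

definition LHSCB :: "real \<Rightarrow> 'a::euclidean_space set \<Rightarrow> ('a \<Rightarrow> real) \<Rightarrow> bool" where
  "LHSCB \<theta> K F \<longleftrightarrow>
     1 \<le> \<theta> \<and>
     C3_on (interior K) F \<and>
     convex_on (interior K) F \<and>
     (\<forall>X z. (\<forall>k::nat. X k \<in> interior K) \<and> X \<longlonglongrightarrow> z \<and> z \<in> frontier K \<longrightarrow>
        filterlim (\<lambda>k. F (X k)) at_top sequentially) \<and>
     (\<forall>x\<in>interior K. \<forall>t>0. F (t *\<^sub>R x) = F x - \<theta> * ln t) \<and>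
     (\<forall>x\<in>interior K. \<forall>h. \<bar>third F x h h \<bullet> h\<bar> \<le> 2 * (hess F x h \<bullet> h) powr (3/2))"

definition conj_barrier :: "'a::euclidean_space set \<Rightarrow> ('a \<Rightarrow> real) \<Rightarrow> 'a \<Rightarrow> real" where
  "conj_barrier K F s = (SUP x\<in>interior K. - (s \<bullet> x) - F x)"

definition mu :: "real \<Rightarrow> 'a::euclidean_space \<Rightarrow> 'a \<Rightarrow> real" where
  "mu \<theta> x s = (s \<bullet> x) / \<theta>"

definition primal_shadow :: "'a::euclidean_space set \<Rightarrow> ('a \<Rightarrow> real) \<Rightarrow> 'a \<Rightarrow> 'a" where
  "primal_shadow K F s = - grad (conj_barrier K F) s"

definition dual_shadow :: "('a::euclidean_space \<Rightarrow> real) \<Rightarrow> 'a \<Rightarrow> 'a" where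
  "dual_shadow F x = - grad F x"

definition delta_D :: "real \<Rightarrow> ('a::euclidean_space \<Rightarrow> real) \<Rightarrow> 'a \<Rightarrow> 'a \<Rightarrow> 'a" where
  "delta_D \<theta> F x s = s - mu \<theta> x s *\<^sub>R dual_shadow F x"

definition self_adjoint :: "('a::euclidean_space \<Rightarrow>\<^sub>L 'a) \<Rightarrow> bool" where
  "self_adjoint A \<longleftrightarrow> adjoint (blinfun_apply A) = blinfun_apply A"

definition positive_definite :: "('a::euclidean_space \<Rightarrow>\<^sub>L 'a) \<Rightarrow> bool" where
  "positive_definite A \<longleftrightarrow> (\<forall>u. u \<noteq> 0 \<longrightarrow> 0 < u \<bullet> A u)"

definition is_spd_sqrt :: "('a::euclidean_space \<Rightarrow>\<^sub>L 'a) \<Rightarrow> ('a \<Rightarrow>\<^sub>L 'a) \<Rightarrow> bool" where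
  "is_spd_sqrt A T \<longleftrightarrow> self_adjoint T \<and> positive_definite T \<and> T o\<^sub>L T = A"

definition spd_sqrt :: "('a::euclidean_space \<Rightarrow>\<^sub>L 'a) \<Rightarrow> ('a \<Rightarrow>\<^sub>L 'a)" where
  "spd_sqrt A = (THE T. is_spd_sqrt A T)"

definition scalings_T1 ::
    "'a::euclidean_space set \<Rightarrow> ('a \<Rightarrow> real) \<Rightarrow> 'a \<Rightarrow> 'a \<Rightarrow> ('a \<Rightarrow>\<^sub>L 'a) set" where
  "scalings_T1 K F x s =
     {T. self_adjoint T \<and> positive_definite T \<and>
         (T o\<^sub>L T) s = x \<and> (T o\<^sub>L T) (dual_shadow F x) = primal_shadow K F s}"

definition T_D_squared ::
    "real \<Rightarrow> 'a::euclidean_space set \<Rightarrow> ('a \<Rightarrow> real) \<Rightarrow> 'a \<Rightarrow> 'a \<Rightarrow> ('a \<Rightarrow>\<^sub>L 'a)" where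
  "T_D_squared \<theta> K F x s =
     mu \<theta> x s *\<^sub>R integral {0..1} (\<lambda>t. hess (conj_barrier K F) (s - t *\<^sub>R delta_D \<theta> F x s))"

end

theory Submission
  imports Defs
begin

text \<open>
  The map \<open>- F'\<close> is a bijection from the interior of \<open>K\<close> onto the interior of the dual cone: it is
  injective and open because \<open>F''\<close> is positive definite (self-concordance and pointedness of \<open>K\<close>),
  and onto because \<open>s + F'\<close> vanishes at the minimiser of \<open>s \<bullet> y + F y\<close>. If \<open>G\<close> is its inverse,
  then \<open>F\<^sub>*' = - G\<close> and \<open>F\<^sub>*''\<close> is the pointwise inverse of \<open>F''\<close> along \<open>G\<close>; in particular it is
  continuous and positive definite. With \<open>p t = s - t *\<^sub>R \<delta>\<close>, homogeneity gives
  \<open>F\<^sub>*''(p t) (p t) = G (p t)\<close>, so \<open>F\<^sub>*''(p t) s\<close> and \<open>F\<^sub>*''(p t) (p 1)\<close> are the derivatives of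
  \<open>t *\<^sub>R G (p t)\<close> and \<open>(t - 1) *\<^sub>R G (p t)\<close>, and both integrals are evaluated at the end points.
\<close>

subsection \<open>Square roots of positive definite maps\<close>

lemma self_adjoint_iff: "self_adjoint A \<longleftrightarrow> (\<forall>u v. A u \<bullet> v = u \<bullet> A v)"
  unfolding self_adjoint_def
  by (metis adjoint_unique adjoint_works blinfun.bounded_linear_right bounded_linear.linear inner_commute)

text \<open>A unit vector of \<open>S\<close> maximising the Rayleigh quotient is an eigenvector: if
  the residual \<open>r = M *\<^sub>R v - f v\<close> were nonzero, a small move from
  \<open>v\<close> along \<open>- r\<close>, which stays in \<open>S\<close>, would exceed the
  maximum.\<close>

lemma symmetric_eigenvector_exists:
  fixes f :: "'a::euclidean_space \<Rightarrow> 'a"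
  assumes lin: "linear f" and sub: "subspace S" and inv: "f ` S \<subseteq> S"
    and sym: "\<And>u v. f u \<bullet> v = u \<bullet> f v" and ne: "S \<noteq> {0}"
  obtains v c where "v \<in> S" "norm v = 1" "f v = c *\<^sub>R v"
proof -
  let ?C = "sphere 0 1 \<inter> S"
  interpret linear f by (rule lin)
  obtain w where w: "w \<in> S" "w \<noteq> 0" using ne sub subspace_0 by blast
  then have "(1 / norm w) *\<^sub>R w \<in> ?C" using sub by (auto simp: subspace_scale)
  moreover have "compact ?C" using closed_subspace[OF sub] by (simp add: compact_Int_closed)
  moreover have "continuous_on ?C (\<lambda>v. v \<bullet> f v)"
    by (intro continuous_intros linear_continuous_on linear_conv_bounded_linear[THEN iffD1] lin)
  ultimately obtain v where v: "v \<in> ?C" and max: "\<And>y. y \<in> ?C \<Longrightarrow> y \<bullet> f y \<le> v \<bullet> f v"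
    using continuous_attains_sup[of ?C "\<lambda>v. v \<bullet> f v"] by blast
  define M where "M = v \<bullet> f v"
  have M: "y \<bullet> f y \<le> M * (y \<bullet> y)" if "y \<in> S" for y
  proof (cases "y = 0")
    case False
    then have "(1 / norm y) *\<^sub>R y \<in> ?C" using sub that by (auto simp: subspace_scale)
    from max[OF this] have "(y \<bullet> f y) / (norm y)\<^sup>2 \<le> M"
      by (simp add: M_def scale power2_eq_square)
    then show ?thesis using False by (simp add: power2_norm_eq_inner divide_le_eq)
  qed (simp add: zero)
  define r where "r = M *\<^sub>R v - f v"
  have vS: "v \<in> S" and vv: "v \<bullet> v = 1" using v by (auto simp: norm_eq_1)
  have rS: "r \<in> S" unfolding r_def using vS inv sub by (intro subspace_diff subspace_scale) auto
  define b where "b = M * (r \<bullet> r) - r \<bullet> f r"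
  have b: "0 \<le> b" using M[OF rS] by (simp add: b_def)
  \<comment> \<open>Maximality gives \<open>2 * t * (r \<bullet> r) \<le> t * (t * b)\<close> for
    every step \<open>t\<close>. This choice ensures \<open>t * b \<le> r \<bullet> r\<close>, which
    forces \<open>t * (r \<bullet> r) \<le> 0\<close>; the \<open>+ 1\<close> keeps the denominator
    positive when \<open>b = 0\<close>.\<close>
  define t where "t = (r \<bullet> r) / (b + 1)"
  have t0: "0 \<le> t" using b by (simp add: t_def)
  have rr: "r \<bullet> r = M * (v \<bullet> r) - v \<bullet> f r"
    using sym[of v r] by (subst (1) r_def) (simp add: inner_simps)
  have "v - t *\<^sub>R r \<in> S" using vS rS sub by (intro subspace_diff subspace_scale)
  from M[OF this] have "0 \<le> t\<^sup>2 * b - 2 * t * (M * (v \<bullet> r) - v \<bullet> f r)"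
    using sym[of v r] vv unfolding b_def
    by (simp add: diff scale inner_simps M_def[symmetric] power2_eq_square algebra_simps inner_commute)
  then have "2 * t * (r \<bullet> r) \<le> t * (t * b)" unfolding rr[symmetric] by (simp add: power2_eq_square algebra_simps)
  moreover have "t * b \<le> r \<bullet> r" using b by (simp add: t_def divide_le_eq mult_left_mono)
  then have "t * (t * b) \<le> t * (r \<bullet> r)" using t0 by (rule mult_left_mono)
  ultimately have "t * (r \<bullet> r) \<le> 0" by linarith
  then have "r \<bullet> r = 0"
    using b inner_ge_zero[of r] by (auto simp: t_def divide_le_0_iff mult_le_0_iff)
  then have "f v = M *\<^sub>R v" by (simp add: r_def)
  with vS vv that show thesis by (simp add: norm_eq_1)
qed

text \<open>Spectral theorem by induction on the dimension: split off a unit eigenvector; by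
  symmetry its orthogonal complement inside \<open>S\<close> is again invariant.\<close>

lemma symmetric_orthonormal_eigenbasis:
  fixes f :: "'a::euclidean_space \<Rightarrow> 'a"
  assumes lin: "linear f" and sym: "\<And>u v. f u \<bullet> v = u \<bullet> f v"
    and "subspace S" "f ` S \<subseteq> S"
  shows "\<exists>B\<subseteq>S. pairwise orthogonal B \<and> (\<forall>b\<in>B. norm b = 1) \<and> span B = S \<and> (\<forall>b\<in>B. \<exists>c. f b = c *\<^sub>R b)"
  using assms(3,4)
proof (induction "dim S" arbitrary: S rule: less_induct)
  case less
  show ?case
  proof (cases "S = {0}")
    case True
    then show ?thesis by (intro exI[of _ "{}"]) auto
  next
    case False
    obtain v c where v: "v \<in> S" "norm v = 1" "f v = c *\<^sub>R v"
      using symmetric_eigenvector_exists[OF lin less.prems sym False] .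
    have vv: "v \<bullet> v = 1" using v by (simp add: norm_eq_1)
    define S' where "S' = S \<inter> {y. v \<bullet> y = 0}"
    have sub': "subspace S'" unfolding S'_def
      by (intro subspace_inter less.prems subspace_hyperplane)
    have inv': "f ` S' \<subseteq> S'"
      using less.prems(2) sym[of v] v(3) by (auto simp: S'_def image_subset_iff inner_simps)
        (metis inner_scaleR_left mult_zero_right)
    have "v \<notin> S'" using vv by (simp add: S'_def)
    with v(1) have "S' \<subset> S" unfolding S'_def by blast
    then have "dim S' < dim S" 
      by (metis sub' less.prems(1) dim_psubset span_eq_iff)
    from less.hyps[OF this sub' inv'] obtain B where B: "B \<subseteq> S'" "pairwise orthogonal B"
      "\<forall>b\<in>B. norm b = 1" "span B = S'" "\<forall>b\<in>B. \<exists>c. f b = c *\<^sub>R b" by blast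
    have "span (insert v B) = S"
    proof
      show "span (insert v B) \<subseteq> S"
        using B(1) v(1) less.prems(1) by (intro span_minimal) (auto simp: S'_def)
      show "S \<subseteq> span (insert v B)"
      proof
        fix y assume "y \<in> S"
        then have "y - (v \<bullet> y) *\<^sub>R v \<in> S'"
          using v(1) vv less.prems(1) by (auto simp: S'_def inner_simps subspace_diff subspace_scale)
        then have "y - (v \<bullet> y) *\<^sub>R v \<in> span (insert v B)" using B(4) span_mono[of B "insert v B"] by blast
        moreover have "(v \<bullet> y) *\<^sub>R v \<in> span (insert v B)" by (simp add: span_base span_scale)
        ultimately show "y \<in> span (insert v B)" using span_add by fastforce
      qed
    qed
    moreover have "pairwise orthogonal (insert v B)"
      using B(1,2) by (auto simp: pairwise_insert S'_def orthogonal_def inner_commute)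
    moreover have "insert v B \<subseteq> S" using B(1) v(1) by (auto simp: S'_def)
    ultimately show ?thesis using B(3,5) v(2,3) by (intro exI[of _ "insert v B"]) auto
  qed
qed

text \<open>Existence takes square roots of the eigenvalues in an orthonormal eigenbasis of
  \<open>A\<close>. For uniqueness, any root is shown to act on this same basis as \<open>T\<close>
  does.\<close>

lemma ex1_spd_sqrt:
  fixes A :: "'a::euclidean_space \<Rightarrow>\<^sub>L 'a"
  assumes sa: "self_adjoint A" and pd: "positive_definite A"
  shows "\<exists>!T. is_spd_sqrt A T"
proof -
  have lin: "linear A" by (simp add: blinfun.bounded_linear_right bounded_linear.linear)
  obtain B where B: "pairwise orthogonal B" "\<And>b. b \<in> B \<Longrightarrow> norm b = 1" "span B = UNIV"
    and eig: "\<forall>b\<in>B. \<exists>c. A b = c *\<^sub>R b"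
    using symmetric_orthonormal_eigenbasis[OF lin _ subspace_UNIV] sa
    unfolding self_adjoint_iff by auto
  \<comment> \<open>For a unit eigenvector \<open>b\<close>, the number
    \<open>b \<bullet> A b\<close> is its eigenvalue.\<close>
  define c where "c b = sqrt (b \<bullet> A b)" for b
  have c: "A b = (c b)\<^sup>2 *\<^sub>R b" "0 < c b" if "b \<in> B" for b
  proof -
    have bb: "b \<bullet> b = 1" using B(2)[OF that] by (simp add: norm_eq_1)
    then have "0 < b \<bullet> A b" using pd unfolding positive_definite_def by (metis inner_zero_left zero_neq_one)
    then show "0 < c b" by (simp add: c_def)
    from eig that obtain d where "A b = d *\<^sub>R b" by blast
    then show "A b = (c b)\<^sup>2 *\<^sub>R b" using bb \<open>0 < b \<bullet> A b\<close> by (simp add: c_def)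
  qed
  have fin: "finite B" using B(1) pairwise_orthogonal_imp_finite by blast
  have orth: "b \<bullet> b' = (if b = b' then 1 else 0)" if "b \<in> B" "b' \<in> B" for b b'
    using B(1,2) that by (auto simp: pairwise_def orthogonal_def norm_eq_1)
  have eqI: "S = T" if "\<And>b. b \<in> B \<Longrightarrow> S b = T b" for S T :: "'a \<Rightarrow>\<^sub>L 'a"
  proof (rule blinfun_eqI)
    fix u have "u \<in> span B" using B(3) by simp
    then show "S u = T u"
      by (rule linear_eq_on_span[rotated 3])
        (auto intro: that bounded_linear.linear blinfun.bounded_linear_right)
  qed
  define T where "T = Blinfun (\<lambda>u. \<Sum>b\<in>B. (c b * (u \<bullet> b)) *\<^sub>R b)"
  have T: "T u = (\<Sum>b\<in>B. (c b * (u \<bullet> b)) *\<^sub>R b)" for u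
    unfolding T_def by (subst bounded_linear_Blinfun_apply)
      (auto intro!: bounded_linear_intros)
  have Tb: "T b = c b *\<^sub>R b" if "b \<in> B" for b
  proof -
    have "T b = (\<Sum>b'\<in>B. if b' = b then c b *\<^sub>R b else 0)"
      unfolding T using that by (intro sum.cong) (auto simp: orth)
    then show ?thesis using fin that by simp
  qed
  have "is_spd_sqrt A T" unfolding is_spd_sqrt_def
  proof (intro conjI)
    show "self_adjoint T"
      unfolding self_adjoint_iff T by (auto simp: inner_sum_left inner_sum_right inner_commute intro!: sum.cong)
    show "T o\<^sub>L T = A"
      by (rule eqI) (simp add: Tb c blinfun.scaleR_right power2_eq_square)
    show "positive_definite T" unfolding positive_definite_def
    proof safe
      fix u :: 'a assume "u \<noteq> 0"
      have "\<exists>b\<in>B. u \<bullet> b \<noteq> 0"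
      proof (rule ccontr)
        assume "\<not> ?thesis"
        then have "orthogonal u u"
          using B(3) by (intro orthogonal_to_span[of u B]) (auto simp: orthogonal_def)
        with \<open>u \<noteq> 0\<close> show False by (simp add: orthogonal_def)
      qed
      then obtain b where b: "b \<in> B" "u \<bullet> b \<noteq> 0" by blast
      have "u \<bullet> T u = (\<Sum>b\<in>B. c b * (u \<bullet> b)\<^sup>2)"
        by (simp add: T inner_sum_right power2_eq_square mult.assoc)
      also have "\<dots> > 0"
        using b c(2) by (intro sum_pos2[OF fin b(1)]) (auto simp: less_imp_le)
      finally show "0 < u \<bullet> T u" .
    qed
  qed
  moreover have "R = T" if R: "is_spd_sqrt A R" for R
  proof (rule eqI)
    fix b assume b: "b \<in> B"
    \<comment> \<open>\<open>R w + c b *\<^sub>R w\<close> equals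
      \<open>R (R b) - (c b)\<^sup>2 *\<^sub>R b\<close>, which is 0. Since \<open>R\<close> plus a
      positive multiple of the identity is positive definite, \<open>w = 0\<close>.\<close>
    define w where "w = R b - c b *\<^sub>R b"
    have "R (R b) = A b" using R unfolding is_spd_sqrt_def by (metis blinfun_apply_blinfun_compose)
    then have "R w + c b *\<^sub>R w = 0"
      by (simp add: w_def blinfun.bilinear_simps c[OF b] power2_eq_square algebra_simps)
    then have "w \<bullet> R w + c b * (w \<bullet> w) = 0" by (metis inner_add_right inner_scaleR_right inner_zero_right)
    moreover have "0 \<le> c b * (w \<bullet> w)" using c(2)[OF b] by simp
    ultimately have "w = 0"
      using R unfolding is_spd_sqrt_def positive_definite_def by (metis add_pos_nonneg less_irrefl)
    then show "R b = T b" by (simp add: w_def Tb[OF b])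
  qed
  ultimately show ?thesis by blast
qed

lemma is_spd_sqrt_spd_sqrt:
  assumes "self_adjoint A" "positive_definite A"
  shows "is_spd_sqrt A (spd_sqrt A)"
  unfolding spd_sqrt_def using ex1_spd_sqrt[OF assms] by (rule theI')

subsection \<open>Gradients and Hessians\<close>

lemma GDERIV_unique:
  assumes "GDERIV f x :> g" "GDERIV f x :> h"
  shows "g = h"
proof -
  have "(\<lambda>u. u \<bullet> g) = (\<lambda>u. u \<bullet> h)"
    using assms unfolding gderiv_def by (rule has_derivative_unique)
  then have "\<forall>u. u \<bullet> g = u \<bullet> h" by (simp add: fun_eq_iff)
  then show ?thesis by (simp only: vector_eq_ldot)
qed

lemma grad_eqI:
  assumes "GDERIV f x :> g"
  shows "grad f x = g"
  unfolding grad_def using assms by (rule the_equality) (rule GDERIV_unique[OF _ assms])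

lemma GDERIV_grad:
  fixes f :: "'a::euclidean_space \<Rightarrow> real"
  assumes "f differentiable (at x)"
  shows "GDERIV f x :> grad f x"
proof -
  obtain f' where f': "(f has_derivative f') (at x)" using assms by (auto simp: differentiable_def)
  then have "linear f'" by (rule has_derivative_linear)
  then have "(\<lambda>h. h \<bullet> adjoint f' 1) = f'" by (simp add: adjoint_works)
  with f' have "GDERIV f x :> adjoint f' 1" by (simp add: gderiv_def)
  then show ?thesis by (simp add: grad_eqI)
qed

lemma Blinfun_frechet_derivative_has_derivative:
  assumes "f differentiable (at x)"
  shows "(f has_derivative blinfun_apply (Blinfun (frechet_derivative f (at x)))) (at x)"
proof -
  have *: "(f has_derivative frechet_derivative f (at x)) (at x)"
    using assms frechet_derivative_works by blast
  show ?thesis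
    unfolding bounded_linear_Blinfun_apply[OF has_derivative_bounded_linear[OF *]] by (rule *)
qed

lemma hess_eqI: "(grad F has_derivative blinfun_apply A) (at x) \<Longrightarrow> hess F x = A"
  unfolding hess_def by (drule frechet_derivative_at, drule sym) (simp add: blinfun_apply_inverse)

text \<open>The second difference of \<open>F\<close> over the parallelogram spanned by
  \<open>t *\<^sub>R u\<close> and \<open>t *\<^sub>R v\<close> is symmetric in \<open>u\<close> and
  \<open>v\<close>, and it equals \<open>t\<^sup>2 * (H v \<bullet> u)\<close> up to an error of
  smaller order than \<open>t\<^sup>2\<close>.\<close>

lemma GDERIV_derivative_symmetric:
  fixes F :: "'a::real_inner \<Rightarrow> real"
  assumes S: "open S" "x \<in> S" and F: "\<And>y. y \<in> S \<Longrightarrow> GDERIV F y :> g y"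
    and g: "(g has_derivative H) (at x)"
  shows "H u \<bullet> v = u \<bullet> H v"
proof -
  have bl: "bounded_linear H" using g by (rule has_derivative_bounded_linear)
  interpret H: bounded_linear H by (rule bl)
  \<comment> \<open>The mean value theorem in direction \<open>u\<close> turns the second difference
    into \<open>t\<close> times an increment of \<open>g\<close> along \<open>t *\<^sub>R v\<close>;
    differentiability of \<open>g\<close> at \<open>x\<close> replaces that increment by
    \<open>t *\<^sub>R H v\<close>.\<close>
  have approx: "\<exists>d>0. \<forall>t. 0 < t \<and> t * (norm u + norm v) < d \<longrightarrow>
      \<bar>F (x + t *\<^sub>R u + t *\<^sub>R v) - F (x + t *\<^sub>R u) - F (x + t *\<^sub>R v) + F x - t\<^sup>2 * (H v \<bullet> u)\<bar>
        \<le> t\<^sup>2 * (e * (2 * (norm u + norm v) * norm u))"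
    if e: "0 < e" for e and u v :: 'a
  proof -
    obtain d1 where d1: "0 < d1" "ball x d1 \<subseteq> S" using S by (meson openE)
    obtain d2 where d2: "0 < d2"
      "\<And>y. norm (y - x) < d2 \<Longrightarrow> norm (g y - g x - H (y - x)) \<le> e * norm (y - x)"
      using g e unfolding has_derivative_at_alt by blast
    define N where "N = norm u + norm v"
    show ?thesis
    proof (intro exI[of _ "min d1 d2"] conjI allI impI)
      show "0 < min d1 d2" using d1 d2 by simp
      fix t :: real assume t: "0 < t \<and> t * (norm u + norm v) < min d1 d2"
      have nb: "norm (r *\<^sub>R u) \<le> t * N" "norm (r *\<^sub>R u + t *\<^sub>R v) \<le> t * N" if "0 \<le> r" "r \<le> t" for r
      proof -
        have "r * norm u \<le> t * norm u" using that by (simp add: mult_right_mono)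
        moreover have "0 \<le> t * norm v" using t by simp
        ultimately show "norm (r *\<^sub>R u) \<le> t * N" using that(1) by (simp add: N_def algebra_simps)
        have "norm (r *\<^sub>R u + t *\<^sub>R v) \<le> r * norm u + t * norm v"
          using that t by (intro norm_triangle_le) simp
        then show "norm (r *\<^sub>R u + t *\<^sub>R v) \<le> t * N"
          using \<open>r * norm u \<le> t * norm u\<close> by (simp add: N_def algebra_simps)
      qed
      have tN: "t * N < d1" "t * N < d2" using t by (auto simp: N_def)
      have inS: "x + r *\<^sub>R u \<in> S" "x + r *\<^sub>R u + t *\<^sub>R v \<in> S" if "0 \<le> r" "r \<le> t" for r
        using nb[OF that] tN d1(2) by (auto simp: subset_iff dist_norm norm_minus_commute add.assoc)
      \<comment> \<open>The second difference is \<open>?f t - ?f 0\<close>, so one intermediate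
        point \<open>z\<close> serves both gradient terms.\<close>
      let ?f = "\<lambda>r. F (x + r *\<^sub>R u + t *\<^sub>R v) - F (x + r *\<^sub>R u)"
      have der: "(?f has_real_derivative (g (x + r *\<^sub>R u + t *\<^sub>R v) - g (x + r *\<^sub>R u)) \<bullet> u) (at r)"
        if "0 \<le> r" "r \<le> t" for r
      proof -
        have 1: "((\<lambda>r. x + r *\<^sub>R u + t *\<^sub>R v) has_derivative (\<lambda>h. h *\<^sub>R u)) (at r)"
          "((\<lambda>r. x + r *\<^sub>R u) has_derivative (\<lambda>h. h *\<^sub>R u)) (at r)"
          by (auto intro!: derivative_eq_intros)
        note 2 = has_derivative_compose[OF 1(1) F[OF inS(2)[OF that], unfolded gderiv_def]]
          and 3 = has_derivative_compose[OF 1(2) F[OF inS(1)[OF that], unfolded gderiv_def]]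
        show ?thesis unfolding has_field_derivative_def
          by (rule has_derivative_eq_rhs[OF has_derivative_diff[OF 2 3]])
            (auto simp: inner_simps inner_commute algebra_simps)
      qed
      obtain z where z: "0 < z" "z < t"
        "?f t - ?f 0 = (t - 0) * ((g (x + z *\<^sub>R u + t *\<^sub>R v) - g (x + z *\<^sub>R u)) \<bullet> u)"
        using MVT2[of 0 t ?f, OF _ der] t by auto
      define w where "w = g (x + z *\<^sub>R u + t *\<^sub>R v) - g (x + z *\<^sub>R u) - t *\<^sub>R H v"
      have zt: "0 \<le> z" "z \<le> t" using z by auto
      have a: "norm (g (x + (z *\<^sub>R u + t *\<^sub>R v)) - g x - H (z *\<^sub>R u + t *\<^sub>R v)) \<le> e * (t * N)"
      proof -
        have "norm (g (x + (z *\<^sub>R u + t *\<^sub>R v)) - g x - H (z *\<^sub>R u + t *\<^sub>R v)) \<le> e * norm (z *\<^sub>R u + t *\<^sub>R v)"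
          using d2(2)[of "x + (z *\<^sub>R u + t *\<^sub>R v)"] nb(2)[OF zt] tN by simp
        also have "\<dots> \<le> e * (t * N)" using nb(2)[OF zt] e by simp
        finally show ?thesis .
      qed
      have b: "norm (g (x + z *\<^sub>R u) - g x - H (z *\<^sub>R u)) \<le> e * (t * N)"
      proof -
        have "norm (g (x + z *\<^sub>R u) - g x - H (z *\<^sub>R u)) \<le> e * norm (z *\<^sub>R u)"
          using d2(2)[of "x + z *\<^sub>R u"] nb(1)[OF zt] tN by simp
        also have "\<dots> \<le> e * (t * N)" using nb(1)[OF zt] e by (intro mult_left_mono) auto
        finally show ?thesis .
      qed
      \<comment> \<open>Both gradients are linearised at \<open>x\<close>; on subtracting,
        \<open>g x\<close> and \<open>H (z *\<^sub>R u)\<close> cancel and only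
        \<open>t *\<^sub>R H v\<close> remains.\<close>
      have weq: "w = (g (x + (z *\<^sub>R u + t *\<^sub>R v)) - g x - H (z *\<^sub>R u + t *\<^sub>R v)) - (g (x + z *\<^sub>R u) - g x - H (z *\<^sub>R u))"
        by (simp add: w_def H.add H.scaleR add.assoc)
      then have "norm w \<le> e * (t * N) + e * (t * N)"
        using order_trans[OF norm_triangle_ineq4 add_mono[OF a b]] by simp
      then have nw: "norm w \<le> 2 * e * t * N" by (simp add: mult_ac)
      have "F (x + t *\<^sub>R u + t *\<^sub>R v) - F (x + t *\<^sub>R u) - F (x + t *\<^sub>R v) + F x - t\<^sup>2 * (H v \<bullet> u) = t * (w \<bullet> u)"
      proof -
        have "F (x + t *\<^sub>R u + t *\<^sub>R v) - F (x + t *\<^sub>R u) - F (x + t *\<^sub>R v) + F x = ?f t - ?f 0" by simp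
        also have "\<dots> = t * ((w + t *\<^sub>R H v) \<bullet> u)" unfolding z(3) by (simp add: w_def)
        finally show ?thesis by (simp add: inner_add_left power2_eq_square distrib_left)
      qed
      also have "\<bar>\<dots>\<bar> \<le> t * (norm w * norm u)" using t by (simp add: abs_mult Cauchy_Schwarz_ineq2)
      also have "\<dots> \<le> t * ((2 * e * t * N) * norm u)"
        using nw t by (intro mult_left_mono mult_right_mono) auto
      finally show "\<bar>F (x + t *\<^sub>R u + t *\<^sub>R v) - F (x + t *\<^sub>R u) - F (x + t *\<^sub>R v) + F x - t\<^sup>2 * (H v \<bullet> u)\<bar>
        \<le> t\<^sup>2 * (e * (2 * (norm u + norm v) * norm u))"
        by (simp add: N_def power2_eq_square algebra_simps)
    qed
  qed
  have le: "\<bar>H v \<bullet> u - H u \<bullet> v\<bar> \<le> e * (2 * (norm u + norm v)\<^sup>2)" if e: "0 < e" for e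
  proof -
    define N where "N = norm u + norm v"
    from approx[OF e, of u v] obtain d1 where d1: "d1 > 0" "\<And>t. 0 < t \<Longrightarrow> t * N < d1 \<Longrightarrow> 
      \<bar>F (x + t *\<^sub>R u + t *\<^sub>R v) - F (x + t *\<^sub>R u) - F (x + t *\<^sub>R v) + F x - t\<^sup>2 * (H v \<bullet> u)\<bar>
        \<le> t\<^sup>2 * (e * (2 * N * norm u))" unfolding N_def by blast
    from approx[OF e, of v u] obtain d2 where d2: "d2 > 0" "\<And>t. 0 < t \<Longrightarrow> t * N < d2 \<Longrightarrow> 
      \<bar>F (x + t *\<^sub>R v + t *\<^sub>R u) - F (x + t *\<^sub>R v) - F (x + t *\<^sub>R u) + F x - t\<^sup>2 * (H u \<bullet> v)\<bar>
        \<le> t\<^sup>2 * (e * (2 * N * norm v))" unfolding N_def add.commute[of "norm u"] by blast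
    \<comment> \<open>The factor 2 makes \<open>t * N\<close> strictly smaller than both radii;
      \<open>N + 1\<close> covers the case \<open>N = 0\<close>.\<close>
    define t where "t = min d1 d2 / (2 * (N + 1))"
    have N0: "0 \<le> N" by (simp add: N_def)
    have t: "0 < t" using d1 d2 N0 by (simp add: t_def)
    have "t * N \<le> t * (N + 1)" using t by simp
    also have "\<dots> = min d1 d2 / 2" using N0 by (simp add: t_def field_simps)
    also have "\<dots> < min d1 d2" using d1(1) d2(1) by linarith
    finally have "t * N < d1" "t * N < d2" by auto
    note 1 = d1(2)[OF t this(1)] and 2 = d2(2)[OF t this(2)]
    have eq: "x + t *\<^sub>R v + t *\<^sub>R u = x + t *\<^sub>R u + t *\<^sub>R v" by simp
    from 1 2[unfolded eq] have "\<bar>t\<^sup>2 * (H v \<bullet> u) - t\<^sup>2 * (H u \<bullet> v)\<bar> \<le> t\<^sup>2 * (e * (2 * N * norm u)) + t\<^sup>2 * (e * (2 * N * norm v))"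
      by linarith
    moreover have "t\<^sup>2 * (e * (2 * N * norm u)) + t\<^sup>2 * (e * (2 * N * norm v)) = t\<^sup>2 * (e * (2 * N\<^sup>2))"
      by (simp add: N_def power2_eq_square algebra_simps)
    moreover have "t\<^sup>2 * (H v \<bullet> u) - t\<^sup>2 * (H u \<bullet> v) = t\<^sup>2 * (H v \<bullet> u - H u \<bullet> v)"
      by (rule right_diff_distrib[symmetric])
    ultimately have "t\<^sup>2 * \<bar>H v \<bullet> u - H u \<bullet> v\<bar> \<le> t\<^sup>2 * (e * (2 * N\<^sup>2))"
      by (simp only: abs_mult abs_power2)
    then show ?thesis using t by (simp add: N_def)
  qed
  have "\<bar>H v \<bullet> u - H u \<bullet> v\<bar> \<le> 0"
  proof (rule field_le_epsilon)
    fix e :: real assume e: "0 < e"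
    define M where "M = 2 * (norm u + norm v)\<^sup>2 + 1"
    have M: "0 < M" by (simp add: M_def add_nonneg_pos)
    have "\<bar>H v \<bullet> u - H u \<bullet> v\<bar> \<le> e / M * (2 * (norm u + norm v)\<^sup>2)"
      using e M by (intro le) simp
    also have "\<dots> \<le> e / M * M" using e M by (intro mult_left_mono) (auto simp: M_def)
    finally show "\<bar>H v \<bullet> u - H u \<bullet> v\<bar> \<le> 0 + e" using M by simp
  qed
  then show ?thesis by (simp add: inner_commute)
qed

subsection \<open>Inverses and integrals of positive definite maps\<close>

definition blinfun_inverse :: "('a::euclidean_space \<Rightarrow>\<^sub>L 'a) \<Rightarrow> ('a \<Rightarrow>\<^sub>L 'a)" where
  "blinfun_inverse A = Blinfun (inv (blinfun_apply A))"

text \<open>A positive definite map has trivial kernel, and in finite dimension an injective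
  endomorphism is onto, so the inverse is two-sided.\<close>

lemma
  fixes A :: "'a::euclidean_space \<Rightarrow>\<^sub>L 'a"
  assumes "positive_definite A"
  shows blinfun_inverse_left: "blinfun_inverse A (A u) = u"
    and blinfun_inverse_right: "A (blinfun_inverse A u) = u"
proof -
  have lin: "linear A" by (simp add: blinfun.bounded_linear_right bounded_linear.linear)
  have inj: "inj A"
    unfolding linear_injective_0[OF lin]
    using assms unfolding positive_definite_def by force
  then have surj: "surj A" by (rule linear_injective_imp_surjective[OF lin]) simp
  have *: "blinfun_apply (blinfun_inverse A) = inv A"
    unfolding blinfun_inverse_def
    by (rule bounded_linear_Blinfun_apply)
      (simp add: inj_linear_imp_inv_linear inj lin linear_conv_bounded_linear[symmetric])
  show "blinfun_inverse A (A u) = u" unfolding * by (rule inv_f_f[OF inj])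
  show "A (blinfun_inverse A u) = u" unfolding * by (rule surj_f_inv_f[OF surj])
qed

lemma self_adjoint_blinfun_inverse:
  assumes "positive_definite A" "self_adjoint A"
  shows "self_adjoint (blinfun_inverse A)"
  unfolding self_adjoint_iff
proof (intro allI)
  fix u v
  have "A (blinfun_inverse A u) \<bullet> blinfun_inverse A v = blinfun_inverse A u \<bullet> A (blinfun_inverse A v)"
    using assms(2) unfolding self_adjoint_iff by blast
  then show "blinfun_inverse A u \<bullet> v = u \<bullet> blinfun_inverse A v"
    by (simp add: blinfun_inverse_right[OF assms(1)])
qed

lemma positive_definite_blinfun_inverse:
  assumes "positive_definite A"
  shows "positive_definite (blinfun_inverse A)"
  unfolding positive_definite_def
proof safe
  fix u :: 'a assume "u \<noteq> 0"
  then have "blinfun_inverse A u \<noteq> 0" using blinfun_inverse_right[OF assms, of u] by auto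
  then have "0 < blinfun_inverse A u \<bullet> A (blinfun_inverse A u)"
    using assms unfolding positive_definite_def by blast
  then show "0 < u \<bullet> blinfun_inverse A u" by (simp add: blinfun_inverse_right[OF assms] inner_commute)
qed

text \<open>With \<open>B\<close> and \<open>D\<close> the inverses of \<open>A\<close> and
  \<open>C\<close>, the identity \<open>D = B - B (C - A) D\<close> together with smallness first
  bounds \<open>D u\<close> by twice the bound for \<open>B u\<close>; feeding this back into the
  identity gives the estimate.\<close>

lemma norm_blinfun_inverse_diff_le:
  fixes A C :: "'a::euclidean_space \<Rightarrow>\<^sub>L 'a"
  assumes A: "positive_definite A" and C: "positive_definite C"
    and small: "norm (blinfun_inverse A) * norm (C - A) \<le> 1/2"
  shows "norm (blinfun_inverse C - blinfun_inverse A) \<le> 2 * (norm (blinfun_inverse A))\<^sup>2 * norm (C - A)"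
proof (rule norm_blinfun_bound)
  let ?B = "blinfun_inverse A" and ?D = "blinfun_inverse C"
  show "0 \<le> 2 * (norm ?B)\<^sup>2 * norm (C - A)" by simp
  fix u
  have eq: "?D u = ?B u - ?B ((C - A) (?D u))"
    by (simp add: blinfun.bilinear_simps blinfun_inverse_left[OF A] blinfun_inverse_right[OF C])
  have bd: "norm (?B ((C - A) (?D u))) \<le> norm ?B * norm (C - A) * norm (?D u)"
    using order_trans[OF norm_blinfun mult_left_mono[OF norm_blinfun norm_ge_zero]] by (simp add: mult.assoc)
  also have "\<dots> \<le> 1/2 * norm (?D u)" using small by (rule mult_right_mono) simp
  finally have "norm (?B ((C - A) (?D u))) \<le> norm (?D u) / 2" by simp
  moreover have "norm (?D u) \<le> norm (?B u) + norm (?B ((C - A) (?D u)))"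
    by (subst eq) (rule norm_triangle_ineq4)
  ultimately have "norm (?D u) \<le> 2 * norm (?B u)" by simp
  also have "\<dots> \<le> 2 * (norm ?B * norm u)" by (simp add: norm_blinfun)
  finally have D: "norm (?D u) \<le> 2 * (norm ?B * norm u)" .
  have "(?D - ?B) u = - ?B ((C - A) (?D u))"
    unfolding blinfun.diff_left[of ?D] by (subst eq) simp
  then have "norm ((?D - ?B) u) = norm (?B ((C - A) (?D u)))" by simp
  also note bd
  also have "norm ?B * norm (C - A) * norm (?D u) \<le> norm ?B * norm (C - A) * (2 * (norm ?B * norm u))"
    using D by (intro mult_left_mono) auto
  finally show "norm ((?D - ?B) u) \<le> 2 * (norm ?B)\<^sup>2 * norm (C - A) * norm u"
    by (simp add: power2_eq_square algebra_simps)
qed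

lemma continuous_on_blinfun_inverse:
  fixes A :: "'b::topological_space \<Rightarrow> 'a::euclidean_space \<Rightarrow>\<^sub>L 'a"
  assumes cont: "continuous_on S A" and pd: "\<And>x. x \<in> S \<Longrightarrow> positive_definite (A x)"
  shows "continuous_on S (\<lambda>x. blinfun_inverse (A x))"
  unfolding continuous_on_def
proof
  fix x assume x: "x \<in> S"
  let ?B = "blinfun_inverse (A x)"
  have "(A \<longlongrightarrow> A x) (at x within S)" using cont x by (simp add: continuous_on_def)
  then have lim: "((\<lambda>y. norm (A y - A x)) \<longlongrightarrow> 0) (at x within S)"
    by (simp add: LIM_zero tendsto_norm_zero)
  have lim1: "((\<lambda>y. norm ?B * norm (A y - A x)) \<longlongrightarrow> 0) (at x within S)"
    using tendsto_mult_right_zero[OF lim] .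
  have lim2: "((\<lambda>y. 2 * (norm ?B)\<^sup>2 * norm (A y - A x)) \<longlongrightarrow> 0) (at x within S)"
    using tendsto_mult_right_zero[OF lim] .
  have "eventually (\<lambda>y. norm ?B * norm (A y - A x) < 1/2) (at x within S)"
    using order_tendstoD(2)[OF lim1, of "1/2"] by simp
  moreover have "eventually (\<lambda>y. y \<in> S) (at x within S)" by (simp add: eventually_at_filter)
  ultimately have "eventually (\<lambda>y. norm (blinfun_inverse (A y) - ?B) \<le> 2 * (norm ?B)\<^sup>2 * norm (A y - A x)) (at x within S)"
    by eventually_elim (intro norm_blinfun_inverse_diff_le pd x, auto)
  then have "((\<lambda>y. blinfun_inverse (A y) - ?B) \<longlongrightarrow> 0) (at x within S)"
    by (rule Lim_null_comparison[OF _ lim2])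
  then show "((\<lambda>y. blinfun_inverse (A y)) \<longlongrightarrow> ?B) (at x within S)" by (simp add: LIM_zero_iff)
qed

text \<open>Evaluation at \<open>u\<close> is bounded linear and so commutes with the integral. This
  reduces the operator-valued integral to vector-valued ones, to which the fundamental theorem of
  calculus applies.\<close>

lemma integral_blinfun_apply:
  fixes H :: "real \<Rightarrow> 'a::euclidean_space \<Rightarrow>\<^sub>L 'b::euclidean_space"
  assumes "continuous_on {a..b} H"
  shows "((\<lambda>t. H t u) has_integral (integral {a..b} H) u) {a..b}"
proof -
  have "(H has_integral integral {a..b} H) {a..b}"
    using assms by (intro integrable_integral integrable_continuous_real)
  from has_integral_linear[OF this blinfun.bounded_linear_left[of u]] show ?thesis by (simp add: o_def)
qed

lemma self_adjoint_integral:
  fixes H :: "real \<Rightarrow> 'a::euclidean_space \<Rightarrow>\<^sub>L 'a"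
  assumes cont: "continuous_on {a..b} H" and sa: "\<And>t. t \<in> {a..b} \<Longrightarrow> self_adjoint (H t)"
  shows "self_adjoint (integral {a..b} H)"
  unfolding self_adjoint_iff
proof (intro allI)
  fix u v
  have 1: "((\<lambda>t. H t u \<bullet> v) has_integral (integral {a..b} H u \<bullet> v)) {a..b}"
    using has_integral_linear[OF integral_blinfun_apply[OF cont] bounded_linear_inner_left] by (simp add: o_def)
  have 2: "((\<lambda>t. u \<bullet> H t v) has_integral (u \<bullet> integral {a..b} H v)) {a..b}"
    using has_integral_linear[OF integral_blinfun_apply[OF cont] bounded_linear_inner_right] by (simp add: o_def)
  have "((\<lambda>t. H t u \<bullet> v) has_integral (u \<bullet> integral {a..b} H v)) {a..b}"
    by (rule has_integral_eq[OF _ 2]) (use sa in \<open>simp add: self_adjoint_iff\<close>)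
  with 1 show "integral {a..b} H u \<bullet> v = u \<bullet> integral {a..b} H v" by (rule has_integral_unique)
qed

text \<open>By compactness the integrand \<open>u \<bullet> H t u\<close> attains a minimum, which
  is still positive and bounds the integral from below.\<close>

lemma positive_definite_integral:
  fixes H :: "real \<Rightarrow> 'a::euclidean_space \<Rightarrow>\<^sub>L 'a"
  assumes cont: "continuous_on {a..b} H" and pd: "\<And>t. t \<in> {a..b} \<Longrightarrow> positive_definite (H t)"
    and ab: "a < b"
  shows "positive_definite (integral {a..b} H)"
  unfolding positive_definite_def
proof safe
  fix u :: 'a assume u: "u \<noteq> 0"
  have int: "((\<lambda>t. u \<bullet> H t u) has_integral (u \<bullet> integral {a..b} H u)) {a..b}"
    using has_integral_linear[OF integral_blinfun_apply[OF cont] bounded_linear_inner_right] by (simp add: o_def)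
  have "continuous_on {a..b} (\<lambda>t. u \<bullet> H t u)" by (intro continuous_intros cont)
  then obtain r where r: "r \<in> {a..b}" "\<And>t. t \<in> {a..b} \<Longrightarrow> u \<bullet> H r u \<le> u \<bullet> H t u"
    using continuous_attains_inf[of "{a..b}" "\<lambda>t. u \<bullet> H t u"] ab by auto
  have "0 < (b - a) * (u \<bullet> H r u)" using pd[OF r(1)] u ab unfolding positive_definite_def by simp
  also have "((\<lambda>t. u \<bullet> H r u) has_integral (b - a) * (u \<bullet> H r u)) {a..b}"
    using has_integral_const_real[of "u \<bullet> H r u" a b] ab by simp
  from has_integral_le[OF this int r(2)]
  have "(b - a) * (u \<bullet> H r u) \<le> u \<bullet> integral {a..b} H u" by simp
  finally show "0 < u \<bullet> integral {a..b} H u" .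
qed

subsection \<open>Barriers on the primal cone\<close>

locale lhscb =
  fixes K :: "'a::euclidean_space set" and F :: "'a \<Rightarrow> real" and \<theta> :: real
  assumes cone: "proper_cone K" and barrier: "LHSCB \<theta> K F"
begin

lemma closed_K: "closed K" and convex_K: "convex K" and conic_K: "conic K"
  and pointed: "K \<inter> uminus ` K = {0}" and interior_ne: "interior K \<noteq> {}"
  using cone unfolding proper_cone_def convex_cone_def by auto

lemma theta_ge_1: "1 \<le> \<theta>"
  using barrier unfolding LHSCB_def by blast

lemma convex_F: "convex_on (interior K) F"
  using barrier unfolding LHSCB_def by blast

lemma F_at_frontier:
  assumes "\<And>k::nat. X k \<in> interior K" "X \<longlonglongrightarrow> z" "z \<in> frontier K"
  shows "filterlim (\<lambda>k. F (X k)) at_top sequentially"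
  using barrier assms unfolding LHSCB_def by blast

lemma F_scaleR: "x \<in> interior K \<Longrightarrow> 0 < t \<Longrightarrow> F (t *\<^sub>R x) = F x - \<theta> * ln t"
  using barrier unfolding LHSCB_def by blast

lemma self_concordance:
  "x \<in> interior K \<Longrightarrow> \<bar>third F x h h \<bullet> h\<bar> \<le> 2 * (hess F x h \<bullet> h) powr (3/2)"
  using barrier unfolding LHSCB_def by blast

lemma GDERIV_F: "x \<in> interior K \<Longrightarrow> GDERIV F x :> grad F x"
  using barrier unfolding LHSCB_def C3_on_def by (simp add: GDERIV_grad)

lemma grad_has_derivative: "x \<in> interior K \<Longrightarrow> (grad F has_derivative hess F x) (at x)"
  using barrier unfolding LHSCB_def C3_on_def hess_def
  by (simp add: Blinfun_frechet_derivative_has_derivative)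

lemma hess_has_derivative: "x \<in> interior K \<Longrightarrow> (hess F has_derivative third F x) (at x)"
  using barrier unfolding LHSCB_def C3_on_def third_def
  by (simp add: Blinfun_frechet_derivative_has_derivative)

lemma continuous_on_F: "continuous_on (interior K) F"
  using GDERIV_F unfolding gderiv_def
  by (meson continuous_at_imp_continuous_on has_derivative_continuous)

lemma continuous_on_grad: "continuous_on (interior K) (grad F)"
  using grad_has_derivative by (meson continuous_at_imp_continuous_on has_derivative_continuous)

lemma continuous_on_hess: "continuous_on (interior K) (hess F)"
  using hess_has_derivative by (meson continuous_at_imp_continuous_on has_derivative_continuous)

lemma self_adjoint_hess: "x \<in> interior K \<Longrightarrow> self_adjoint (hess F x)"
  unfolding self_adjoint_iff
  using GDERIV_derivative_symmetric[OF open_interior _ GDERIV_F grad_has_derivative] by blast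

lemma scaleR_interior: 
  assumes "x \<in> interior K" "0 < t" shows "t *\<^sub>R x \<in> interior K"
proof -
  have "(*\<^sub>R) t ` K \<subseteq> K" using conic_K assms(2) by (auto simp: conic_def)
  then have "interior ((*\<^sub>R) t ` K) \<subseteq> interior K" by (rule interior_mono)
  moreover have "interior ((*\<^sub>R) t ` K) = (*\<^sub>R) t ` interior K"
    using assms(2) by (intro interior_injective_linear_image) (auto simp: inj_on_def)
  ultimately show ?thesis using assms(1) by blast
qed

lemma line_derivatives:
  assumes "x + t *\<^sub>R h \<in> interior K"
  shows "((\<lambda>r. F (x + r *\<^sub>R h)) has_real_derivative (grad F (x + t *\<^sub>R h) \<bullet> h)) (at t)"
    and "((\<lambda>r. grad F (x + r *\<^sub>R h) \<bullet> h) has_real_derivative (hess F (x + t *\<^sub>R h) h \<bullet> h)) (at t)"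
    and "((\<lambda>r. hess F (x + r *\<^sub>R h) h \<bullet> h) has_real_derivative (third F (x + t *\<^sub>R h) h h \<bullet> h)) (at t)"
proof -
  have line: "((\<lambda>r. x + r *\<^sub>R h) has_derivative (\<lambda>r. r *\<^sub>R h)) (at t)"
    by (auto intro!: derivative_eq_intros)
  note 1 = has_derivative_compose[OF line GDERIV_F[OF assms, unfolded gderiv_def]]
    and 2 = has_derivative_compose[OF line grad_has_derivative[OF assms]]
    and 3 = has_derivative_compose[OF line hess_has_derivative[OF assms]]
  show "((\<lambda>r. F (x + r *\<^sub>R h)) has_real_derivative (grad F (x + t *\<^sub>R h) \<bullet> h)) (at t)"
    unfolding has_field_derivative_def
    by (rule has_derivative_eq_rhs[OF 1]) (auto simp: inner_commute)
  show "((\<lambda>r. grad F (x + r *\<^sub>R h) \<bullet> h) has_real_derivative (hess F (x + t *\<^sub>R h) h \<bullet> h)) (at t)"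
    unfolding has_field_derivative_def
    by (rule has_derivative_eq_rhs[OF has_derivative_inner_left[OF 2]])
      (auto simp: blinfun.scaleR_right)
  have "((\<lambda>r. hess F (x + r *\<^sub>R h) h) has_derivative (\<lambda>r. third F (x + t *\<^sub>R h) (r *\<^sub>R h) h)) (at t)"
    using bounded_linear.has_derivative[OF blinfun.bounded_linear_left 3] .
  from has_derivative_inner_left[OF this]
  show "((\<lambda>r. hess F (x + r *\<^sub>R h) h \<bullet> h) has_real_derivative (third F (x + t *\<^sub>R h) h h \<bullet> h)) (at t)"
    unfolding has_field_derivative_def
    by (rule has_derivative_eq_rhs) (auto simp: blinfun.scaleR_right blinfun.scaleR_left)
qed

section \<open>First- and second-order consequences of convexity\<close>

lemma F_above_tangent:
  assumes x: "x \<in> interior K" and y: "y \<in> interior K"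
  shows "F x + grad F x \<bullet> (y - x) \<le> F y"
proof -
  have "((\<lambda>r. F (x + r *\<^sub>R (y - x))) has_real_derivative (grad F x \<bullet> (y - x))) (at 0)"
    using line_derivatives(1)[of x 0 "y - x"] x by simp
  then have lim: "((\<lambda>r. (F (x + r *\<^sub>R (y - x)) - F x) / r) \<longlongrightarrow> grad F x \<bullet> (y - x)) (at_right 0)"
    by (auto simp: has_field_derivative_iff intro: tendsto_within_subset)
  have "eventually (\<lambda>r::real. 0 < r \<and> r < 1) (at_right 0)"
    by (rule eventually_at_rightI[of 0 1]) auto
  \<comment> \<open>Convexity bounds every right difference quotient along the segment by
    \<open>F y - F x\<close>, and the bound passes to the limit.\<close>
  then have "eventually (\<lambda>r. (F (x + r *\<^sub>R (y - x)) - F x) / r \<le> F y - F x) (at_right 0)"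
  proof eventually_elim
    case (elim r)
    have "x + r *\<^sub>R (y - x) = (1 - r) *\<^sub>R x + r *\<^sub>R y" by (simp add: algebra_simps)
    then have "F (x + r *\<^sub>R (y - x)) \<le> (1 - r) * F x + r * F y"
      using convex_onD[OF convex_F, of r x y] x y elim by simp
    then have "F (x + r *\<^sub>R (y - x)) - F x \<le> (F y - F x) * r" by (simp add: algebra_simps)
    with elim show ?case by (simp add: divide_le_eq)
  qed
  with lim have "grad F x \<bullet> (y - x) \<le> F y - F x"
    by (intro tendsto_upperbound) auto
  then show ?thesis by simp
qed

text \<open>Sum of the tangent inequalities at \<open>x\<close> and at \<open>y\<close>.\<close>

lemma grad_mono:
  assumes "x \<in> interior K" "y \<in> interior K"
  shows "grad F x \<bullet> (y - x) \<le> grad F y \<bullet> (y - x)"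
  using F_above_tangent[OF assms] F_above_tangent[OF assms(2,1)] by (simp add: inner_diff_right)

text \<open>A negative second derivative along \<open>h\<close> would make the directional
  derivative drop just to the right of 0, against monotonicity of the gradient.\<close>

lemma hess_nonneg:
  assumes x: "x \<in> interior K"
  shows "0 \<le> hess F x h \<bullet> h"
proof (rule ccontr)
  assume "\<not> ?thesis"
  moreover have "((\<lambda>r. grad F (x + r *\<^sub>R h) \<bullet> h) has_real_derivative (hess F x h \<bullet> h)) (at 0)"
    using line_derivatives(2)[of x 0 h] x by simp
  ultimately obtain d where d: "0 < d" "\<And>r. 0 < r \<Longrightarrow> r < d \<Longrightarrow> grad F (x + r *\<^sub>R h) \<bullet> h < grad F x \<bullet> h"
    using DERIV_neg_dec_right[of "\<lambda>r. grad F (x + r *\<^sub>R h) \<bullet> h" _ 0] by (auto simp: not_le)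
  have "((\<lambda>r. x + r *\<^sub>R h) \<longlongrightarrow> x) (at_right 0)" by (auto intro!: tendsto_eq_intros)
  then have "eventually (\<lambda>r. x + r *\<^sub>R h \<in> interior K) (at_right 0)"
    using x by (rule topological_tendstoD[OF _ open_interior])
  moreover have "eventually (\<lambda>r. 0 < r \<and> r < d) (at_right 0)"
    by (rule eventually_at_rightI[of 0 d]) (use d in auto)
  ultimately have "eventually (\<lambda>r. x + r *\<^sub>R h \<in> interior K \<and> 0 < r \<and> r < d) (at_right (0::real))"
    by eventually_elim auto
  then obtain r where r: "x + r *\<^sub>R h \<in> interior K" "0 < r" "r < d"
    using eventually_happens' trivial_limit_at_right_real by blast
  from grad_mono[OF x r(1)] have "grad F x \<bullet> h \<le> grad F (x + r *\<^sub>R h) \<bullet> h" using r(2) by simp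
  with d(2)[OF r(2,3)] show False by simp
qed

text \<open>The ray must leave the interior: otherwise dividing \<open>x + k *\<^sub>R h\<close> by
  \<open>k\<close> and letting \<open>k\<close> grow would put \<open>h\<close> into the closed
  cone.\<close>

lemma exit_point:
  assumes x: "x \<in> interior K" and h: "h \<notin> K"
  obtains T where "0 < T" "x + T *\<^sub>R h \<in> frontier K" "\<And>t. 0 \<le> t \<Longrightarrow> t < T \<Longrightarrow> x + t *\<^sub>R h \<in> interior K"
proof -
  \<comment> \<open>Parameters at which the ray is outside the interior. The set is closed, so the
    first exit time is attained.\<close>
  define E where "E = {0..} \<inter> (\<lambda>t. x + t *\<^sub>R h) -` (- interior K)"
  have "closed E" unfolding E_def
    by (intro closed_Int closed_vimage continuous_intros) auto
  moreover have "E \<noteq> {}"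
  proof
    assume "E = {}"
    have "(1 / real (Suc k)) *\<^sub>R (x + real (Suc k) *\<^sub>R h) \<in> K" for k
    proof -
      have "real (Suc k) \<notin> E" using \<open>E = {}\<close> by blast
      then have "x + real (Suc k) *\<^sub>R h \<in> interior K" unfolding E_def by auto
      then show ?thesis using conic_K interior_subset by (intro conicD) auto
    qed
    moreover have "(1 / real (Suc k)) *\<^sub>R (x + real (Suc k) *\<^sub>R h) = inverse (real (Suc k)) *\<^sub>R x + h" for k
      by (simp add: scaleR_add_right divide_inverse del: of_nat_Suc)
    ultimately have "inverse (real (Suc k)) *\<^sub>R x + h \<in> K" for k by (simp only:)
    moreover have "(\<lambda>k. inverse (real (Suc k)) *\<^sub>R x + h) \<longlonglongrightarrow> 0 *\<^sub>R x + h"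
      by (intro tendsto_intros LIMSEQ_inverse_real_of_nat)
    ultimately have "0 *\<^sub>R x + h \<in> K" by (rule closed_sequentially[OF closed_K])
    then have "h \<in> K" by simp
    with h show False by simp
  qed
  moreover have bdd: "bdd_below E" unfolding E_def by (auto intro: bdd_belowI[of _ 0])
  ultimately have inE: "Inf E \<in> E" by (intro closed_contains_Inf)
  define T where "T = Inf E"
  have "T \<ge> 0" "x + T *\<^sub>R h \<notin> interior K" using inE by (auto simp: E_def T_def)
  then have T: "0 < T" using x by (cases "T = 0") auto
  have below: "x + t *\<^sub>R h \<in> interior K" if "0 \<le> t" "t < T" for t
    using cInf_lower[OF _ bdd, of t] that by (fastforce simp: E_def T_def)
  \<comment> \<open>The exit point is a limit of points of \<open>K\<close>, hence in
    \<open>K\<close>; not being interior, it lies on the frontier.\<close>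
  have lim: "((\<lambda>t. x + t *\<^sub>R h) \<longlongrightarrow> x + T *\<^sub>R h) (at_left T)" by (auto intro!: tendsto_eq_intros)
  have ev: "eventually (\<lambda>t. x + t *\<^sub>R h \<in> K) (at_left T)"
    using T below interior_subset[of K] by (intro eventually_at_leftI[of 0]) (auto simp: subset_iff)
  have "x + T *\<^sub>R h \<in> K"
    by (rule Lim_in_closed_set[OF closed_K ev _ lim]) simp
  with \<open>x + T *\<^sub>R h \<notin> interior K\<close> have "x + T *\<^sub>R h \<in> frontier K"
    by (simp add: frontier_def closure_closed[OF closed_K])
  with T below that show thesis by blast
qed

text \<open>If the Hessian form vanished in direction \<open>h\<close> at one point, self-concordance would propagate
  this along the ray (Gronwall), so \<open>F\<close> would be affine, hence bounded, up to the frontier.\<close>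

lemma hess_pos_outside:
  assumes x: "x \<in> interior K" and h: "h \<notin> K"
  shows "0 < hess F x h \<bullet> h"
proof (rule ccontr)
  assume "\<not> ?thesis"
  then have zero: "hess F x h \<bullet> h = 0" using hess_nonneg[OF x, of h] by simp
  obtain T where T: "0 < T" "x + T *\<^sub>R h \<in> frontier K"
    and seg: "\<And>t. 0 \<le> t \<Longrightarrow> t < T \<Longrightarrow> x + t *\<^sub>R h \<in> interior K"
    using exit_point[OF x h] by blast
  let ?p = "\<lambda>t. hess F (x + t *\<^sub>R h) h \<bullet> h" and ?q = "\<lambda>t. third F (x + t *\<^sub>R h) h h \<bullet> h"
  have p0: "?p t = 0" if t: "0 \<le> t" "t < T" for t
  proof -
    have "continuous_on {0..t} ?p"
      using seg t by (intro continuous_at_imp_continuous_on ballI DERIV_isCont[OF line_derivatives(3)]) auto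
    then have "bounded (?p ` {0..t})" by (intro compact_imp_bounded compact_continuous_image) auto
    then obtain M where "\<forall>r\<in>{0..t}. \<bar>?p r\<bar> \<le> M" by (auto simp: bounded_iff)
    then have M: "\<bar>?p r\<bar> \<le> M" if "r \<in> {0..t}" for r using that by (rule bspec)
    \<comment> \<open>On the compact interval \<open>?p\<close> is at most \<open>M\<close>, so the
      power \<open>3/2\<close> in self-concordance is dominated by a linear bound
      \<open>?q r \<le> C * ?p r\<close>. Then \<open>exp (- C * r) * ?p r\<close> is nonincreasing
      and starts at 0.\<close>
    define C where "C = 2 * sqrt M"
    have q: "?q r \<le> C * ?p r" if r: "0 \<le> r" "r \<le> t" for r
    proof -
      have rK: "x + r *\<^sub>R h \<in> interior K" using seg r t by auto
      have pr: "0 \<le> ?p r" by (rule hess_nonneg[OF rK])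
      have "?q r \<le> 2 * ?p r powr (3/2)" using self_concordance[OF rK, of h] by linarith
      also have "?p r powr (3/2) = ?p r * sqrt (?p r)"
        using pr powr_add[of "?p r" 1 "1/2"] by (simp add: powr_half_sqrt)
      finally have "?q r \<le> 2 * (?p r * sqrt (?p r))" .
      moreover have "?p r * sqrt (?p r) \<le> ?p r * sqrt M"
        using pr M[of r] r by (intro mult_left_mono) auto
      ultimately have "?q r \<le> 2 * (?p r * sqrt M)" by linarith
      then show ?thesis by (simp add: C_def mult_ac)
    qed
    have "exp (- C * t) * ?p t \<le> exp (- C * 0) * ?p 0"
    proof (rule DERIV_nonpos_imp_nonincreasing[OF t(1)])
      fix r assume r: "0 \<le> r" "r \<le> t"
      have rK: "x + r *\<^sub>R h \<in> interior K" using seg r t by auto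
      have "((\<lambda>r. exp (- C * r) * ?p r) has_real_derivative exp (- C * r) * (?q r - C * ?p r)) (at r)"
        by (auto intro!: derivative_eq_intros line_derivatives(3)[OF rK] simp: algebra_simps)
      moreover have "exp (- C * r) * (?q r - C * ?p r) \<le> 0" using q[OF r] by (simp add: mult_le_0_iff)
      ultimately show "\<exists>y. ((\<lambda>r. exp (- C * r) * ?p r) has_real_derivative y) (at r) \<and> y \<le> 0" by blast
    qed
    then have "?p t \<le> 0" using zero by (simp add: mult_le_0_iff)
    moreover have "0 \<le> ?p t" using hess_nonneg[OF seg[OF t]] .
    ultimately show ?thesis by simp
  qed
  have "\<exists>a. \<forall>t\<in>{0..<T}. grad F (x + t *\<^sub>R h) \<bullet> h = a"
  proof (rule has_field_derivative_zero_constant)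
    fix t assume "t \<in> {0..<T}"
    then show "((\<lambda>t. grad F (x + t *\<^sub>R h) \<bullet> h) has_real_derivative 0) (at t within {0..<T})"
      using line_derivatives(2)[OF seg, of t] p0[of t] by (auto intro: has_field_derivative_at_within)
  qed auto
  then obtain a where a: "\<And>t. t \<in> {0..<T} \<Longrightarrow> grad F (x + t *\<^sub>R h) \<bullet> h = a" by blast
  have "\<exists>b. \<forall>t\<in>{0..<T}. F (x + t *\<^sub>R h) - t * a = b"
  proof (rule has_field_derivative_zero_constant)
    fix t assume t: "t \<in> {0..<T}"
    have "((\<lambda>t. F (x + t *\<^sub>R h) - t * a) has_real_derivative (grad F (x + t *\<^sub>R h) \<bullet> h - a)) (at t)"
      using t by (auto intro!: derivative_eq_intros line_derivatives(1) seg)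
    then show "((\<lambda>t. F (x + t *\<^sub>R h) - t * a) has_real_derivative 0) (at t within {0..<T})"
      using a[OF t] by (auto intro: has_field_derivative_at_within)
  qed auto
  then obtain b where "\<And>t. t \<in> {0..<T} \<Longrightarrow> F (x + t *\<^sub>R h) - t * a = b" by blast
  then have b: "F (x + t *\<^sub>R h) = b + t * a" if "t \<in> {0..<T}" for t using that by (simp add: diff_eq_eq)
  \<comment> \<open>Parameters in \<open>{0..<T}\<close> tending to \<open>T\<close>. Along them the
    affine formula has the finite limit \<open>b + T * a\<close>, whereas the barrier property
    demands divergence.\<close>
  define \<tau> where "\<tau> k = T - T * inverse (real (Suc k))" for k
  have \<tau>: "\<tau> k \<in> {0..<T}" for k using T by (auto simp: \<tau>_def field_simps)
  have lim: "\<tau> \<longlonglongrightarrow> T - T * 0" unfolding \<tau>_def by (intro tendsto_intros LIMSEQ_inverse_real_of_nat)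
  then have "(\<lambda>k. x + \<tau> k *\<^sub>R h) \<longlonglongrightarrow> x + T *\<^sub>R h" by (auto intro!: tendsto_eq_intros)
  then have "filterlim (\<lambda>k. F (x + \<tau> k *\<^sub>R h)) at_top sequentially"
    using seg \<tau> T(2) by (intro F_at_frontier) auto
  then have "filterlim (\<lambda>k. b + \<tau> k * a) at_top sequentially" using b[OF \<tau>] by simp
  moreover have "(\<lambda>k. b + \<tau> k * a) \<longlonglongrightarrow> b + T * a" using lim by (auto intro!: tendsto_eq_intros)
  ultimately show False
    using not_tendsto_and_filterlim_at_infinity[of sequentially "\<lambda>k. b + \<tau> k * a" "b + T * a"]
    by (simp add: filterlim_at_top_imp_at_infinity)
qed

text \<open>By pointedness one of \<open>h\<close> and \<open>- h\<close> lies outside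
  \<open>K\<close>, and the quadratic form takes the same value at both.\<close>

lemma positive_definite_hess:
  assumes x: "x \<in> interior K"
  shows "positive_definite (hess F x)"
  unfolding positive_definite_def
proof safe
  fix h :: 'a assume "h \<noteq> 0"
  have "h \<notin> K \<or> - h \<notin> K"
  proof (rule ccontr)
    assume "\<not> ?thesis"
    then have "h \<in> K \<inter> uminus ` K" by (auto intro: image_eqI[of _ _ "- h"])
    with \<open>h \<noteq> 0\<close> pointed show False by simp
  qed
  then show "0 < h \<bullet> hess F x h"
    using hess_pos_outside[OF x, of h] hess_pos_outside[OF x, of "- h"]
    by (auto simp: blinfun.minus_right inner_commute)
qed

section \<open>The gradient map and the interior of the dual cone\<close>

lemma zero_notin_interior: "0 \<notin> interior K"
proof
  assume "0 \<in> interior K"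
  then obtain e where e: "0 < e" "ball 0 e \<subseteq> K" by (meson mem_interior)
  obtain b :: 'a where b: "b \<in> Basis" using nonempty_Basis by blast
  have "(e/2) *\<^sub>R b \<in> K" "- ((e/2) *\<^sub>R b) \<in> K" using e b by (auto simp: subset_iff)
  then have "(e/2) *\<^sub>R b \<in> K \<inter> uminus ` K" by (auto intro: image_eqI[of _ _ "- ((e/2) *\<^sub>R b)"])
  then show False using pointed e(1) b by auto
qed

text \<open>Coercivity: \<open>s\<close> can be moved a distance \<open>e\<close> against the
  direction of \<open>y\<close> without leaving the dual cone, and the moved functional is still
  nonnegative at \<open>y\<close>.\<close>

lemma interior_dual_coneE:
  assumes "s \<in> interior (dual_cone K)"
  obtains e where "0 < e" "\<And>y. y \<in> K \<Longrightarrow> e * norm y \<le> s \<bullet> y"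
proof -
  obtain e where e: "0 < e" "cball s e \<subseteq> dual_cone K" using assms by (meson mem_interior_cball)
  have "e * norm y \<le> s \<bullet> y" if y: "y \<in> K" for y
  proof (cases "y = 0")
    case False
    have "s - (e / norm y) *\<^sub>R y \<in> cball s e" using e(1) False by (simp add: dist_norm)
    then have "s - (e / norm y) *\<^sub>R y \<in> dual_cone K" using e(2) by (rule rev_subsetD)
    then have "0 \<le> (s - (e / norm y) *\<^sub>R y) \<bullet> y" using y by (auto simp: dual_cone_def)
    moreover have "(e / norm y) * (y \<bullet> y) = e * norm y"
      using False by (simp add: power2_norm_eq_inner[symmetric] power2_eq_square)
    ultimately show ?thesis by (simp add: inner_diff_left)
  qed simp
  with e(1) that show thesis by blast
qed

lemma inner_pos:
  assumes "s \<in> interior (dual_cone K)" "x \<in> interior K"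
  shows "0 < s \<bullet> x"
proof -
  obtain e where e: "0 < e" "\<And>y. y \<in> K \<Longrightarrow> e * norm y \<le> s \<bullet> y" using interior_dual_coneE assms(1) by blast
  have "x \<noteq> 0" using assms(2) zero_notin_interior by blast
  then have "0 < e * norm x" using e(1) by simp
  also have "\<dots> \<le> s \<bullet> x" using e(2) assms(2) interior_subset by blast
  finally show ?thesis .
qed

text \<open>The mean value theorem on the segment, with the Hessian positive definite there, makes
  the gradient strictly monotone.\<close>

lemma inj_on_neg_grad: "inj_on (\<lambda>z. - grad F z) (interior K)"
proof (rule inj_onI, rule ccontr)
  fix x y assume x: "x \<in> interior K" and y: "y \<in> interior K" and eq: "- grad F x = - grad F y" and ne: "x \<noteq> y"
  let ?h = "y - x"
  have seg: "x + t *\<^sub>R ?h \<in> interior K" if "0 \<le> t" "t \<le> 1" for t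
  proof -
    have "x + t *\<^sub>R ?h = (1 - t) *\<^sub>R x + t *\<^sub>R y" by (simp add: algebra_simps)
    then show ?thesis using convexD_alt[OF convex_interior[OF convex_K] x y] that by simp
  qed
  obtain z where z: "0 < z" "z < 1" "grad F (x + 1 *\<^sub>R ?h) \<bullet> ?h - grad F (x + 0 *\<^sub>R ?h) \<bullet> ?h
      = (1 - 0) * (hess F (x + z *\<^sub>R ?h) ?h \<bullet> ?h)"
    using MVT2[of 0 1 "\<lambda>t. grad F (x + t *\<^sub>R ?h) \<bullet> ?h", OF _ line_derivatives(2)[OF seg]] by auto
  have "0 < ?h \<bullet> hess F (x + z *\<^sub>R ?h) ?h"
    using positive_definite_hess[OF seg[of z]] z ne unfolding positive_definite_def by auto
  then show False using z(3) eq by (simp add: inner_commute)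
qed

text \<open>Membership in the dual cone: a positive slope \<open>grad F x \<bullet> y\<close> would
  force linear growth of \<open>F\<close> along the ray through \<open>y\<close>, where homogeneity
  makes it nonincreasing. Interiority: the image is open by invariance of domain.\<close>

lemma neg_grad_in_interior_dual:
  assumes "x \<in> interior K"
  shows "- grad F x \<in> interior (dual_cone K)"
proof -
  have "- grad F x \<in> dual_cone K" if x: "x \<in> interior K" for x
  proof -
    have "0 \<le> - grad F x \<bullet> y" if y: "y \<in> interior K" for y
    proof (rule ccontr)
      assume "\<not> ?thesis"
      then have a: "0 < grad F x \<bullet> y" by simp
      define c where "c = F y + grad F x \<bullet> x - F x"
      \<comment> \<open>The tangent inequality caps \<open>t * (grad F x \<bullet> y)\<close> at
        \<open>c\<close>, while this \<open>t\<close> makes it at least \<open>c + 1\<close>;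
        \<open>1 \<le> t\<close> ensures \<open>0 \<le> ln t\<close>.\<close>
      define t where "t = max 1 ((c + 1) / (grad F x \<bullet> y))"
      have t: "1 \<le> t" by (simp add: t_def)
      have "F x + grad F x \<bullet> (t *\<^sub>R y - x) \<le> F (t *\<^sub>R y)"
        using F_above_tangent[OF x scaleR_interior[OF y]] t by simp
      also have "\<dots> \<le> F y"
        using F_scaleR[OF y, of t] t theta_ge_1 by simp
      finally have "t * (grad F x \<bullet> y) \<le> c" by (simp add: c_def inner_diff_right)
      moreover have "c + 1 \<le> t * (grad F x \<bullet> y)"
        using a by (simp add: t_def pos_divide_le_eq[symmetric])
      ultimately show False by simp
    qed
    then have "interior K \<subseteq> {y. 0 \<le> - grad F x \<bullet> y}" by blast
    then have "closure (interior K) \<subseteq> {y. 0 \<le> - grad F x \<bullet> y}"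
      by (rule closure_minimal) (rule closed_halfspace_ge)
    then show ?thesis
      using convex_closure_interior[OF convex_K interior_ne] closure_subset[of K]
      by (auto simp: dual_cone_def)
  qed
  then have "(\<lambda>z. - grad F z) ` interior K \<subseteq> dual_cone K" by blast
  moreover have "open ((\<lambda>z. - grad F z) ` interior K)"
    by (intro invariance_of_domain continuous_intros continuous_on_grad inj_on_neg_grad open_interior)
  ultimately have "(\<lambda>z. - grad F z) ` interior K \<subseteq> interior (dual_cone K)" by (rule interior_maximal)
  with assms show ?thesis by blast
qed

text \<open>Coercivity of \<open>s\<close> on \<open>K\<close> bounds the slice, and divergence of
  \<open>F\<close> at the frontier keeps limits of sublevel points in the interior.\<close>

lemma compact_sublevel_slice:
  assumes s: "s \<in> interior (dual_cone K)"
  shows "compact {y \<in> interior K. s \<bullet> y = \<theta> \<and> F y \<le> c}" (is "compact ?L")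
proof -
  obtain e where e: "0 < e" "\<And>y. y \<in> K \<Longrightarrow> e * norm y \<le> s \<bullet> y" using interior_dual_coneE s by blast
  have "norm y \<le> \<theta> / e" if "y \<in> ?L" for y
    using e(2)[of y] e(1) that interior_subset[of K] by (auto simp: pos_le_divide_eq mult.commute)
  then have "bounded ?L" by (auto simp: bounded_iff)
  moreover have "closed ?L"
    unfolding closed_sequential_limits
  proof (intro allI impI, elim conjE)
    fix X z assume X: "\<forall>k. X k \<in> ?L" and lim: "X \<longlonglongrightarrow> z"
    have XK: "X k \<in> interior K" for k using X by blast
    have "z \<in> K" using closed_sequentially[OF closed_K _ lim] XK interior_subset by blast
    have "z \<in> interior K"
    proof (rule ccontr)
      assume "z \<notin> interior K"
      with \<open>z \<in> K\<close> have "z \<in> frontier K" by (simp add: frontier_def closure_closed[OF closed_K])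
      from F_at_frontier[OF XK lim this] have "eventually (\<lambda>k. c < F (X k)) sequentially"
        by (simp add: filterlim_at_top_dense)
      then obtain k where "c < F (X k)" using eventually_happens'[OF sequentially_bot] by blast
      moreover have "F (X k) \<le> c" using X by blast
      ultimately show False by simp
    qed
    moreover have "(\<lambda>k. s \<bullet> X k) \<longlonglongrightarrow> s \<bullet> z" by (intro tendsto_intros lim)
    then have "s \<bullet> z = \<theta>" using X by (simp add: LIMSEQ_const_iff)
    moreover have "(\<lambda>k. F (X k)) \<longlonglongrightarrow> F z"
      using continuous_on_tendsto_compose[OF continuous_on_F lim \<open>z \<in> interior K\<close>] XK by simp
    then have "F z \<le> c" by (rule LIMSEQ_le_const2) (use X in auto)
    ultimately show "z \<in> ?L" by blast
  qed
  ultimately show ?thesis by (simp add: compact_eq_bounded_closed)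
qed

text \<open>By logarithmic homogeneity, minimising \<open>s \<bullet> y + F y\<close> over \<open>interior K\<close> reduces to the slice
  \<open>s \<bullet> y = \<theta>\<close>: along the ray through \<open>y\<close> the minimum is attained on that slice.\<close>

lemma neg_grad_surj:
  assumes s: "s \<in> interior (dual_cone K)"
  obtains z where "z \<in> interior K" "- grad F z = s"
proof -
  \<comment> \<open>The factor that moves \<open>y\<close> along its ray onto the slice.\<close>
  define c where "c y = \<theta> / (s \<bullet> y)" for y
  have c: "0 < c y" "c y *\<^sub>R y \<in> interior K" "s \<bullet> (c y *\<^sub>R y) = \<theta>"
    and Fc: "s \<bullet> (c y *\<^sub>R y) + F (c y *\<^sub>R y) \<le> s \<bullet> y + F y" if y: "y \<in> interior K" for y
  proof -
    have sy: "0 < s \<bullet> y" by (rule inner_pos[OF s y])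
    show c0: "0 < c y" using sy theta_ge_1 by (simp add: c_def)
    show "c y *\<^sub>R y \<in> interior K" by (rule scaleR_interior[OF y c0])
    show th: "s \<bullet> (c y *\<^sub>R y) = \<theta>" using sy by (simp add: c_def)
    \<comment> \<open>By homogeneity the claim \<open>Fc\<close> amounts to
      \<open>- \<theta> * ln (c y) \<le> s \<bullet> y - \<theta>\<close>, which is
      \<open>\<theta>\<close> times the bound of the logarithm by its tangent at 1, taken at
      \<open>inverse (c y)\<close>.\<close>
    have "- ln (c y) = ln (inverse (c y))" using c0 by (simp add: ln_inverse)
    also have "\<dots> \<le> inverse (c y) - 1" using c0 by (intro ln_le_minus_one) simp
    finally have "\<theta> * - ln (c y) \<le> \<theta> * (inverse (c y) - 1)" using theta_ge_1 by (intro mult_left_mono) auto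
    also have "\<dots> = s \<bullet> y - \<theta>" using sy theta_ge_1 by (simp add: c_def algebra_simps)
    finally show "s \<bullet> (c y *\<^sub>R y) + F (c y *\<^sub>R y) \<le> s \<bullet> y + F y"
      unfolding th F_scaleR[OF y c0] by simp
  qed
  obtain y0 where y0: "y0 \<in> interior K" using interior_ne by blast
  define w where "w = c y0 *\<^sub>R y0"
  define L where "L = {y \<in> interior K. s \<bullet> y = \<theta> \<and> F y \<le> F w}"
  have "w \<in> L" using c[OF y0] by (simp add: L_def w_def)
  moreover have "compact L" unfolding L_def by (rule compact_sublevel_slice[OF s])
  moreover have "continuous_on L F" by (rule continuous_on_subset[OF continuous_on_F]) (auto simp: L_def)
  ultimately obtain z where z: "z \<in> L" "\<And>y. y \<in> L \<Longrightarrow> F z \<le> F y"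
    using continuous_attains_inf[of L F] by blast
  then have zK: "z \<in> interior K" and sz: "s \<bullet> z = \<theta>" by (auto simp: L_def)
  have min: "s \<bullet> z + F z \<le> s \<bullet> y + F y" if y: "y \<in> interior K" for y
  proof -
    \<comment> \<open>A rescaled point either lies in \<open>L\<close>, where \<open>z\<close> is
      minimal, or has value above \<open>F w\<close>, which is at least \<open>F z\<close>.\<close>
    have "F z \<le> F (c y *\<^sub>R y)"
    proof (cases "F (c y *\<^sub>R y) \<le> F w")
      case True
      then show ?thesis using z(2) c[OF y] by (simp add: L_def)
    next
      case False
      then show ?thesis using z(1) by (simp add: L_def)
    qed
    then show ?thesis using Fc[OF y] c(3)[OF y] sz by linarith
  qed
  have "GDERIV (\<lambda>y. s \<bullet> y + F y) z :> s + grad F z"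
  proof (rule GDERIV_add[OF _ GDERIV_F[OF zK]])
    show "GDERIV (\<lambda>y. s \<bullet> y) z :> s"
      unfolding gderiv_def by (auto intro!: derivative_eq_intros simp: inner_commute)
  qed
  then have "((\<lambda>y. s \<bullet> y + F y) has_derivative (\<lambda>h. h \<bullet> (s + grad F z))) (at z)"
    by (simp add: gderiv_def)
  from differential_zero_maxmin[OF zK open_interior this] min
  have "(\<lambda>h. h \<bullet> (s + grad F z)) = (\<lambda>h. 0)" by blast
  then have "(s + grad F z) \<bullet> (s + grad F z) = 0" by (rule fun_cong)
  then have "- grad F z = s" by (simp add: add_eq_0_iff)
  with zK that show thesis by blast
qed

section \<open>Derivative identities from logarithmic homogeneity\<close>

lemma grad_scaleR:
  assumes x: "x \<in> interior K" and t: "0 < t"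
  shows "grad F (t *\<^sub>R x) = (1 / t) *\<^sub>R grad F x"
proof -
  \<comment> \<open>The gradient at \<open>x\<close> of \<open>F (t *\<^sub>R y)\<close> in
    \<open>y\<close> is computed twice, by the chain rule and by homogeneity.\<close>
  have "((\<lambda>y. F (t *\<^sub>R y)) has_derivative (\<lambda>h. (t *\<^sub>R h) \<bullet> grad F (t *\<^sub>R x))) (at x)"
    by (rule has_derivative_compose[of "\<lambda>y. t *\<^sub>R y" "\<lambda>h. t *\<^sub>R h" x UNIV F, OF _ GDERIV_F[OF scaleR_interior[OF x t], unfolded gderiv_def]])
      (auto intro!: derivative_eq_intros)
  then have "GDERIV (\<lambda>y. F (t *\<^sub>R y)) x :> t *\<^sub>R grad F (t *\<^sub>R x)" by (simp add: gderiv_def)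
  moreover have "((\<lambda>y. F (t *\<^sub>R y)) has_derivative (\<lambda>h. h \<bullet> grad F x)) (at x)"
  proof (rule has_derivative_transform_within_open[OF _ open_interior x])
    show "((\<lambda>y. F y - \<theta> * ln t) has_derivative (\<lambda>h. h \<bullet> grad F x)) (at x)"
      using GDERIV_F[OF x, unfolded gderiv_def] by (auto intro!: derivative_eq_intros)
  qed (simp add: F_scaleR t)
  ultimately have "t *\<^sub>R grad F (t *\<^sub>R x) = grad F x"
    using GDERIV_unique unfolding gderiv_def by blast
  then show ?thesis using t by (simp add: eq_vector_fraction_iff)
qed

text \<open>Differentiate \<open>grad F (r *\<^sub>R x) = (1 / r) *\<^sub>R grad F x\<close> at
  \<open>r = 1\<close>.\<close>

lemma hess_apply_self:
  assumes x: "x \<in> interior K"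
  shows "hess F x x = - grad F x"
proof -
  have "((\<lambda>r. r *\<^sub>R x) has_derivative (\<lambda>r. r *\<^sub>R x)) (at 1)" by (auto intro!: derivative_eq_intros)
  from has_derivative_compose[OF this, of "grad F" "hess F x"]
  have "((\<lambda>r. grad F (r *\<^sub>R x)) has_derivative (\<lambda>r. hess F x (r *\<^sub>R x))) (at (1::real))"
    using grad_has_derivative[OF x] by simp
  then have "((\<lambda>r. grad F (r *\<^sub>R x)) has_vector_derivative hess F x x) (at 1)"
    by (simp add: has_vector_derivative_def blinfun.scaleR_right)
  moreover have "((\<lambda>r. grad F (r *\<^sub>R x)) has_vector_derivative - grad F x) (at 1)"
  proof (rule has_vector_derivative_transform_within_open[where S = "{0<..}"])
    show "((\<lambda>r. (1 / r) *\<^sub>R grad F x) has_vector_derivative - grad F x) (at 1)"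
      by (auto intro!: derivative_eq_intros)
  qed (auto simp: grad_scaleR[OF x])
  ultimately show ?thesis by (rule vector_derivative_unique_at)
qed

subsection \<open>The conjugate barrier\<close>

text \<open>On the interior of the dual cone this is minus the gradient of the conjugate barrier, as
  \<open>grad_conj_barrier\<close> shows.\<close>

definition grad_inv :: "'a \<Rightarrow> 'a" where
  "grad_inv = inv_into (interior K) (\<lambda>z. - grad F z)"

lemma grad_inv_neg_grad: "z \<in> interior K \<Longrightarrow> grad_inv (- grad F z) = z"
  unfolding grad_inv_def using inv_into_f_f[OF inj_on_neg_grad, of z] by simp

lemma grad_inv:
  assumes "s \<in> interior (dual_cone K)"
  shows grad_inv_interior: "grad_inv s \<in> interior K" and neg_grad_grad_inv: "- grad F (grad_inv s) = s"
proof -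
  obtain z where z: "z \<in> interior K" "- grad F z = s" using neg_grad_surj[OF assms] .
  with grad_inv_neg_grad[OF z(1)] show "grad_inv s \<in> interior K" "- grad F (grad_inv s) = s" by auto
qed

text \<open>Inverse function theorem for the negated gradient, whose derivative is invertible
  because the Hessian is positive definite.\<close>

lemma grad_inv_has_derivative:
  assumes s: "s \<in> interior (dual_cone K)"
  shows "(grad_inv has_derivative (\<lambda>h. - blinfun_inverse (hess F (grad_inv s)) h)) (at s)"
proof (rule has_derivative_inverse_strong_x[where S = "interior K" and f = "\<lambda>z. - grad F z" and f' = "\<lambda>h. - hess F (grad_inv s) h"])
  show "((\<lambda>z. - grad F z) has_derivative (\<lambda>h. - hess F (grad_inv s) h)) (at (grad_inv s))"
    by (intro has_derivative_minus grad_has_derivative grad_inv_interior s)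
  show "(\<lambda>h. - hess F (grad_inv s) h) \<circ> (\<lambda>h. - blinfun_inverse (hess F (grad_inv s)) h) = id"
    by (auto simp: blinfun.minus_right blinfun_inverse_right positive_definite_hess grad_inv_interior s)
qed (auto simp: grad_inv_interior neg_grad_grad_inv s grad_inv_neg_grad intro!: continuous_intros continuous_on_grad)

lemma continuous_on_grad_inv: "continuous_on (interior (dual_cone K)) grad_inv"
  using grad_inv_has_derivative by (meson continuous_at_imp_continuous_on has_derivative_continuous)

text \<open>At \<open>grad_inv s\<close> the gradient of \<open>F\<close> is \<open>- s\<close>, so
  the tangent inequality there says that this point attains the supremum.\<close>

lemma conj_barrier_eq:
  assumes s: "s \<in> interior (dual_cone K)"
  shows "conj_barrier K F s = - (s \<bullet> grad_inv s) - F (grad_inv s)"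
    and conj_barrier_ge: "y \<in> interior K \<Longrightarrow> - (s \<bullet> y) - F y \<le> conj_barrier K F s"
proof -
  have le: "- (s \<bullet> y) - F y \<le> - (s \<bullet> grad_inv s) - F (grad_inv s)" if y: "y \<in> interior K" for y
    using F_above_tangent[OF grad_inv_interior[OF s] y]
      minus_equation_iff[THEN iffD1, OF neg_grad_grad_inv[OF s], symmetric]
    by (simp add: inner_diff_right)
  show eq: "conj_barrier K F s = - (s \<bullet> grad_inv s) - F (grad_inv s)"
    unfolding conj_barrier_def
    by (rule cSup_eq_maximum) (use le grad_inv_interior[OF s] in auto)
  show "- (s \<bullet> y) - F y \<le> conj_barrier K F s" if "y \<in> interior K"
    unfolding eq by (rule le[OF that])
qed

text \<open>The remainder \<open>R\<close> is squeezed by two Fenchel inequalities. At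
  \<open>y\<close>, tested with \<open>grad_inv s\<close>, it is nonnegative; at \<open>s\<close>,
  tested with \<open>grad_inv y\<close>, it is at most
  \<open>(y - s) \<bullet> (grad_inv s - grad_inv y)\<close>, which is of smaller order than
  \<open>y - s\<close> by continuity of \<open>grad_inv\<close>.\<close>

lemma GDERIV_conj_barrier:
  assumes s: "s \<in> interior (dual_cone K)"
  shows "GDERIV (conj_barrier K F) s :> - grad_inv s"
  unfolding gderiv_def has_derivative_at_alt
proof (intro conjI allI impI)
  show "bounded_linear (\<lambda>h. h \<bullet> - grad_inv s)" by (rule bounded_linear_inner_left)
  fix e :: real assume e: "0 < e"
  obtain d1 where d1: "0 < d1" "ball s d1 \<subseteq> interior (dual_cone K)"
    using s by (meson open_interior openE)
  have "isCont grad_inv s" using grad_inv_has_derivative[OF s] by (rule has_derivative_continuous)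
  then obtain d2 where d2: "0 < d2" "\<And>y. dist y s < d2 \<Longrightarrow> dist (grad_inv y) (grad_inv s) < e"
    using e unfolding continuous_at_eps_delta by blast
  show "\<exists>d>0. \<forall>y. norm (y - s) < d \<longrightarrow>
      norm (conj_barrier K F y - conj_barrier K F s - (y - s) \<bullet> - grad_inv s) \<le> e * norm (y - s)"
  proof (intro exI[of _ "min d1 d2"] conjI allI impI)
    show "0 < min d1 d2" using d1 d2 by simp
    fix y assume y: "norm (y - s) < min d1 d2"
    then have yD: "y \<in> interior (dual_cone K)"
      using d1(2) by (auto simp: subset_iff dist_norm norm_minus_commute)
    define R where "R = conj_barrier K F y - conj_barrier K F s - (y - s) \<bullet> - grad_inv s"
    have "0 \<le> R"
      using conj_barrier_ge[OF yD grad_inv_interior[OF s]] conj_barrier_eq[OF s]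
      by (simp add: R_def inner_diff_left)
    moreover have "R \<le> (y - s) \<bullet> (grad_inv s - grad_inv y)"
      using conj_barrier_ge[OF s grad_inv_interior[OF yD]] conj_barrier_eq[OF yD]
      by (simp add: R_def inner_diff_left inner_diff_right)
    moreover have "(y - s) \<bullet> (grad_inv s - grad_inv y) \<le> norm (y - s) * norm (grad_inv s - grad_inv y)"
      by (rule norm_cauchy_schwarz)
    moreover have "norm (grad_inv s - grad_inv y) \<le> e"
      using d2(2)[of y] y by (simp add: dist_norm norm_minus_commute)
    then have "norm (y - s) * norm (grad_inv s - grad_inv y) \<le> norm (y - s) * e"
      by (rule mult_left_mono) simp
    ultimately show "norm (conj_barrier K F y - conj_barrier K F s - (y - s) \<bullet> - grad_inv s) \<le> e * norm (y - s)"
      unfolding R_def[symmetric] by (simp add: mult.commute)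
  qed
qed

lemma grad_conj_barrier: "s \<in> interior (dual_cone K) \<Longrightarrow> grad (conj_barrier K F) s = - grad_inv s"
  by (rule grad_eqI[OF GDERIV_conj_barrier])

lemma hess_conj_barrier:
  assumes s: "s \<in> interior (dual_cone K)"
  shows "hess (conj_barrier K F) s = blinfun_inverse (hess F (grad_inv s))"
proof (rule hess_eqI)
  have "((\<lambda>s. - grad_inv s) has_derivative blinfun_inverse (hess F (grad_inv s))) (at s)"
    using has_derivative_minus[OF grad_inv_has_derivative[OF s]] by simp
  then show "(grad (conj_barrier K F) has_derivative blinfun_inverse (hess F (grad_inv s))) (at s)"
    by (rule has_derivative_transform_within_open[OF _ open_interior s]) (simp add: grad_conj_barrier)
qed

text \<open>Inverts \<open>hess_apply_self\<close> at \<open>grad_inv s\<close>, where the Hessian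
  of \<open>F\<close> maps \<open>grad_inv s\<close> to \<open>s\<close>.\<close>

lemma hess_conj_barrier_apply_self:
  assumes s: "s \<in> interior (dual_cone K)"
  shows "hess (conj_barrier K F) s s = grad_inv s"
proof -
  let ?z = "grad_inv s"
  have "hess F ?z ?z = s" using hess_apply_self[OF grad_inv_interior[OF s]] neg_grad_grad_inv[OF s] by simp
  then show ?thesis
    using blinfun_inverse_left[OF positive_definite_hess[OF grad_inv_interior[OF s]], of ?z]
    by (simp add: hess_conj_barrier[OF s])
qed

lemma positive_definite_hess_conj_barrier:
  "s \<in> interior (dual_cone K) \<Longrightarrow> positive_definite (hess (conj_barrier K F) s)"
  by (simp add: hess_conj_barrier positive_definite_blinfun_inverse positive_definite_hess grad_inv_interior)

lemma self_adjoint_hess_conj_barrier: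
  "s \<in> interior (dual_cone K) \<Longrightarrow> self_adjoint (hess (conj_barrier K F) s)"
  by (simp add: hess_conj_barrier self_adjoint_blinfun_inverse positive_definite_hess self_adjoint_hess grad_inv_interior)

lemma continuous_on_hess_conj_barrier:
  "continuous_on (interior (dual_cone K)) (hess (conj_barrier K F))"
proof -
  have "continuous_on (interior (dual_cone K)) (\<lambda>s. blinfun_inverse (hess F (grad_inv s)))"
    by (intro continuous_on_blinfun_inverse positive_definite_hess grad_inv_interior
        continuous_on_compose2[OF continuous_on_hess continuous_on_grad_inv]) (auto simp: grad_inv_interior)
  then show ?thesis by (simp add: hess_conj_barrier cong: continuous_on_cong)
qed

lemma convex_dual_cone: "convex (dual_cone K)"
  unfolding dual_cone_def convex_def by (auto simp: inner_add_left)

section \<open>The averaged conjugate Hessian between \<open>s\<close> and the scaled dual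
  shadow\<close>

context
  fixes x s :: 'a
  assumes x: "x \<in> interior K" and s: "s \<in> interior (dual_cone K)"
begin

abbreviation (input) "m \<equiv> mu \<theta> x s"
abbreviation (input) "\<delta> \<equiv> delta_D \<theta> F x s"
abbreviation (input) "H \<equiv> \<lambda>t. hess (conj_barrier K F) (s - t *\<^sub>R \<delta>)"

lemma mu_pos: "0 < m"
  using inner_pos[OF s x] theta_ge_1 by (simp add: mu_def)

text \<open>Exhibits the far end of the segment as a value of the negated gradient. This places it
  in the interior of the dual cone and identifies its image under \<open>grad_inv\<close>.\<close>

lemma mu_dual_shadow: "m *\<^sub>R dual_shadow F x = - grad F ((1 / m) *\<^sub>R x)"
  using grad_scaleR[OF x, of "1 / m"] mu_pos by (simp add: dual_shadow_def)

text \<open>The point is the convex combination, with weights \<open>1 - t\<close> and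
  \<open>t\<close>, of \<open>s\<close> and \<open>m *\<^sub>R dual_shadow F x\<close>, both
  interior.\<close>

lemma segment_in_interior_dual:
  assumes "t \<in> {0..1}"
  shows "s - t *\<^sub>R \<delta> \<in> interior (dual_cone K)"
proof -
  have "m *\<^sub>R dual_shadow F x \<in> interior (dual_cone K)"
    unfolding mu_dual_shadow using mu_pos by (intro neg_grad_in_interior_dual scaleR_interior x) simp
  from convexD_alt[OF convex_interior[OF convex_dual_cone] s this, of t] assms
  show ?thesis by (simp add: delta_D_def algebra_simps)
qed

lemma continuous_on_hess_segment: "continuous_on {0..1} H"
  by (intro continuous_on_compose2[OF continuous_on_hess_conj_barrier] continuous_intros)
    (auto intro: segment_in_interior_dual)

text \<open>The minus sign in the derivative of \<open>grad_inv\<close> cancels against the velocity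
  \<open>- \<delta>\<close> of the segment.\<close>

lemma grad_inv_segment_has_vector_derivative:
  assumes t: "t \<in> {0..1}"
  shows "((\<lambda>t. grad_inv (s - t *\<^sub>R \<delta>)) has_vector_derivative H t \<delta>) (at t within {0..1})"
proof -
  have "((\<lambda>t. s - t *\<^sub>R \<delta>) has_derivative (\<lambda>r. - (r *\<^sub>R \<delta>))) (at t within {0..1})"
    by (auto intro!: derivative_eq_intros)
  from has_derivative_compose[OF this grad_inv_has_derivative[OF segment_in_interior_dual[OF t]]]
  show ?thesis
    by (simp add: has_vector_derivative_def hess_conj_barrier[OF segment_in_interior_dual[OF t]]
        blinfun.minus_right blinfun.scaleR_right)
qed

lemma hess_segment_apply_self:
  assumes t: "t \<in> {0..1}"
  shows "H t (s - t *\<^sub>R \<delta>) = grad_inv (s - t *\<^sub>R \<delta>)"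
  by (rule hess_conj_barrier_apply_self[OF segment_in_interior_dual[OF t]])

lemma integral_hess_segment_apply: "((\<lambda>t. H t u) has_integral integral {0..1} H u) {0..1}"
  by (rule integral_blinfun_apply[OF continuous_on_hess_segment])

text \<open>The integrand is the exact derivative of \<open>(t - c) *\<^sub>R grad_inv (s - t *\<^sub>R \<delta>)\<close>, because
  \<open>s - c *\<^sub>R \<delta> = (s - t *\<^sub>R \<delta>) + (t - c) *\<^sub>R \<delta>\<close> and the Hessian maps its base point to its image
  under \<open>grad_inv\<close>. Taking \<open>c = 0\<close> and \<open>c = 1\<close> gives the images of \<open>s\<close> and of
  \<open>m *\<^sub>R dual_shadow F x\<close>.\<close>

lemma integral_hess_segment_shift:
  "integral {0..1} H (s - c *\<^sub>R \<delta>) = (1 - c) *\<^sub>R grad_inv (s - \<delta>) + c *\<^sub>R grad_inv s"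
proof -
  let ?G = "\<lambda>t. (t - c) *\<^sub>R grad_inv (s - t *\<^sub>R \<delta>)"
  have "((\<lambda>t. H t (s - c *\<^sub>R \<delta>)) has_integral (?G 1 - ?G 0)) {0..1}"
  proof (rule fundamental_theorem_of_calculus)
    fix t :: real assume t: "t \<in> {0..1}"
    have "H t (s - c *\<^sub>R \<delta>) = H t ((s - t *\<^sub>R \<delta>) + (t - c) *\<^sub>R \<delta>)" by (simp add: algebra_simps)
    also have "\<dots> = (t - c) *\<^sub>R H t \<delta> + grad_inv (s - t *\<^sub>R \<delta>)"
      by (simp only: blinfun.add_right blinfun.scaleR_right hess_segment_apply_self[OF t] add.commute)
    finally show "(?G has_vector_derivative H t (s - c *\<^sub>R \<delta>)) (at t within {0..1})"
      by (auto intro!: derivative_eq_intros grad_inv_segment_has_vector_derivative t)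
  qed simp
  from has_integral_unique[OF integral_hess_segment_apply this] show ?thesis by (simp add: algebra_simps)
qed

lemma T_D_squared_apply: "T_D_squared \<theta> K F x s u = m *\<^sub>R integral {0..1} H u"
  by (simp add: T_D_squared_def blinfun.scaleR_left)

text \<open>The case \<open>c = 0\<close> leaves \<open>grad_inv (s - \<delta>)\<close>, which is
  \<open>(1 / m) *\<^sub>R x\<close>; the outer factor \<open>m\<close> restores
  \<open>x\<close>.\<close>

lemma T_D_squared_s: "T_D_squared \<theta> K F x s s = x"
proof -
  have "s - \<delta> = - grad F ((1 / m) *\<^sub>R x)" unfolding mu_dual_shadow[symmetric] by (simp add: delta_D_def)
  then have "grad_inv (s - \<delta>) = (1 / m) *\<^sub>R x"
    using grad_inv_neg_grad[OF scaleR_interior[OF x], of "1 / m"] mu_pos by simp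
  then show ?thesis using integral_hess_segment_shift[of 0] mu_pos by (simp add: T_D_squared_apply)
qed

lemma T_D_squared_dual_shadow: "T_D_squared \<theta> K F x s (dual_shadow F x) = primal_shadow K F s"
proof -
  \<comment> \<open>Moving the factor \<open>m\<close> into the argument produces the end point
    \<open>s - \<delta>\<close>, the case \<open>c = 1\<close>.\<close>
  have "T_D_squared \<theta> K F x s (dual_shadow F x) = integral {0..1} H (m *\<^sub>R dual_shadow F x)"
    by (simp add: T_D_squared_apply blinfun.scaleR_right)
  also have "m *\<^sub>R dual_shadow F x = s - 1 *\<^sub>R \<delta>" by (simp add: delta_D_def)
  also have "integral {0..1} H (s - 1 *\<^sub>R \<delta>) = grad_inv s" using integral_hess_segment_shift[of 1] by simp
  finally show ?thesis by (simp add: primal_shadow_def grad_conj_barrier[OF s])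
qed

lemma self_adjoint_T_D_squared: "self_adjoint (T_D_squared \<theta> K F x s)"
  using self_adjoint_integral[OF continuous_on_hess_segment
      self_adjoint_hess_conj_barrier[OF segment_in_interior_dual]]
  by (simp add: self_adjoint_iff T_D_squared_apply)

lemma positive_definite_T_D_squared: "positive_definite (T_D_squared \<theta> K F x s)"
  using positive_definite_integral[OF continuous_on_hess_segment
      positive_definite_hess_conj_barrier[OF segment_in_interior_dual]] mu_pos
  by (simp add: positive_definite_def T_D_squared_apply)

end

end

theorem theorem3p1:
  fixes K :: "'a::euclidean_space set" and F :: "'a \<Rightarrow> real" and \<theta> :: real and x s :: 'a
  assumes "proper_cone K"
    and "LHSCB \<theta> K F"
    and "x \<in> interior K"
    and "s \<in> interior (dual_cone K)"
  shows "self_adjoint (T_D_squared \<theta> K F x s)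
    \<and> positive_definite (T_D_squared \<theta> K F x s)
    \<and> T_D_squared \<theta> K F x s s = x
    \<and> T_D_squared \<theta> K F x s (dual_shadow F x) = primal_shadow K F s
    \<and> (\<exists>!T. is_spd_sqrt (T_D_squared \<theta> K F x s) T)
    \<and> spd_sqrt (T_D_squared \<theta> K F x s) \<in> scalings_T1 K F x s"
proof -
  interpret lhscb K F \<theta> using assms(1,2) by unfold_locales
  let ?A = "T_D_squared \<theta> K F x s"
  have sa: "self_adjoint ?A" and pd: "positive_definite ?A"
    and s: "?A s = x" and sh: "?A (dual_shadow F x) = primal_shadow K F s"
    using assms(3,4) by (simp_all add: self_adjoint_T_D_squared positive_definite_T_D_squared
        T_D_squared_s T_D_squared_dual_shadow)
  have "spd_sqrt ?A \<in> scalings_T1 K F x s"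
    using is_spd_sqrt_spd_sqrt[OF sa pd] s sh
    unfolding scalings_T1_def is_spd_sqrt_def by (simp del: blinfun_apply_blinfun_compose)
  with sa pd s sh ex1_spd_sqrt[OF sa pd] show ?thesis by blast
qed

end
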